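(* Let $\lambda,\tau,\alpha>0$ and let $\{X_{nj}: n\ge 1,\ j=1,\dots,k_n\}$ be a row-wise independent triangular array in which each $X_{nj}$ has distribution function $$F(x;\varepsilon_n)=(1-\varepsilon_n)F_1(x)+\varepsilon_n F_2(x),$$ where $F_1(x)=1-e^{-\lambda x^\tau}$ for $x\ge 0$ (Weibull law), $F_2(x)=1-x^{-\alpha}L(x)$ for $x\in[m,\infty)$ (regularly varying law), $m=\inf\{x>0:F_2(x)>0\}$, and $L$ is a continuous slowly varying function. Assume that $\lim_{x\to\infty}L(x)\in[0,\infty]$ (i.e. this limit exists, finite or infinite). Then for any sequences $k_n\to\infty$, $\varepsilon_n\to0$ there exist deterministic sequences $c_n,s_n$ such that $$\lim_{n\to\infty}\mathbb{P}\Big\{\max_{j=1,\dots,k_n}X_{nj}\le s_nx+c_n\Big\}=H(x)\qquad\text{for all }x\in\mathbb{R},$$ with some non-degenerate limit law $H$. More precisely, with (A1), (A2), (A3) the conditions defined in the context, $H$ belongs to the type of one of the following three distribution functions. (i) Gumbel distribution, $H(x)=e^{-e^{-x}}$, if and only if any of the following conditions is satisfied: (a) $k_n\varepsilon_n\to0$ as $n\to\infty$, or $k_n\varepsilon_n=\mathrm{const}>0$; (b) $k_n\varepsilon_n\to\infty$ as $n\to\infty$, and (A1) holds; (c) (A3) holds, and $L(u)\to0$ as $u\to\infty$. In all these cases, a possible choice of the normalising sequences is $$s_n=(\lambda\tau)^{-1}(\lambda^{-1}\log k_n)^{1/\tau-1},\qquad c_n=(\lambda^{-1}\log k_n)^{1/\tau}.$$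 (ii) Fréchet distribution with parameter $\alpha$, $H(x)=e^{-x^{-\alpha}}$ ($x>0$), if and only if any of the following conditions is satisfied: (a) (A2) holds; (b) (A3) holds, and $L(u)\to\infty$ as $u\to\infty$. In all these cases one can take $$s_n=F_2^{\leftarrow}\big(1-(k_n\varepsilon_n)^{-1}\big),\qquad c_n=0,$$ where $F_2^{\leftarrow}(y)=\inf\{x\in\mathbb{R}:F_2(x)\ge y\}$ for $y\in[0,1]$. (iii) Discontinuous distribution with distribution function $$H(x)=\begin{cases}0,& x<\lambda^{-1/\tau}(c\tilde c)^{-1/\alpha},\\ e^{-(1+x^{-\alpha})},& x=\lambda^{-1/\tau}(c\tilde c)^{-1/\alpha},\\ e^{-x^{-\alpha}},& x>\lambda^{-1/\tau}(c\tilde c)^{-1/\alpha},\end{cases}$$ if (A3) holds (with constant $c$) and $L(u)\to\tilde c$ for some $\tilde c\in(0,\infty)$ as $u\to\infty$. In this case the normalising sequences can be fixed as $s_n=F_2^{\leftarrow}(1-(k_n\varepsilon_n)^{-1})$, $c_n=0$.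
   Context: Here $\varepsilon_n\in(0,1)$ is the mixing parameter and $k_n$ is an unbounded increasing sequence of positive integers; the parameters $\lambda,\tau,\alpha$ and the function $L$ do not depend on $n$. "Row-wise independent" means that for every $n$ the random variables $X_{n1},\dots,X_{nk_n}$ are independent. The function $F_1$ vanishes for $x<0$, $F_2$ vanishes for $x<m$, and the Fréchet distribution function equals $0$ for $x\le0$. A function $L$ is slowly varying if $\lim_{x\to\infty}L(tx)/L(x)=1$ for all $t>0$. Conditions on the rates of $k_n$ and $\varepsilon_n$: - (A1): there exists $\beta>\tau/\alpha$ such that $\lim_{n\to\infty}\frac{\log k_n}{(k_n\varepsilon_n)^\beta}=\infty$. - (A2): there exists $\beta\in(0,\tau/\alpha)$ such that $\lim_{n\to\infty}\frac{\log k_n}{(k_n\varepsilon_n)^\beta}=0$. - (A3): there exists $c>0$ such that $k_n\varepsilon_n=c(\log k_n)^{\alpha/\tau}$. Normalising sequences satisfy $s_n>0$. Two distribution functions $H,G$ are of the same type if $H(x)=G(ax+b)$ for all $x$, with some constants $a>0$, $b\in\mathbb{R}$. The limit law is determined only up to type: if $H$ is a limit law, then any other non-degenerate limit obtained under another normalisation is of the form $H(ax+b)$.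
   Formalization: Rates are restricted to those listed in (i)-(iii), as existence and "only if" fail for arbitrary sequences; in (iii) the printed s_n is claimed to give H at the jump only if log k_n (L(s_n)-c~) tends to 0, and under arbitrary normalisations H is of type (iii) only off the jump. *)

theory Defs
  imports "HOL-Probability.Probability"
begin

definition is_cdf :: "(real \<Rightarrow> real) \<Rightarrow> bool" where
  "is_cdf F \<longleftrightarrow> (\<exists>D. real_distribution D \<and> F = cdf D)"

definition slowly_varying :: "(real \<Rightarrow> real) \<Rightarrow> bool" where
  "slowly_varying L \<longleftrightarrow> (\<forall>t>0. ((\<lambda>x. L (t * x) / L x) \<longlongrightarrow> 1) at_top)"

definition weibull_cdf :: "real \<Rightarrow> real \<Rightarrow> real \<Rightarrow> real" where
  "weibull_cdf lam \<tau> x = (if x < 0 then 0 else 1 - exp (- lam * x powr \<tau>))"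

definition mixture_cdf :: "real \<Rightarrow> (real \<Rightarrow> real) \<Rightarrow> (real \<Rightarrow> real) \<Rightarrow> real \<Rightarrow> real" where
  "mixture_cdf e F1 F2 x = (1 - e) * F1 x + e * F2 x"

definition left_endpoint :: "(real \<Rightarrow> real) \<Rightarrow> real" where
  "left_endpoint F = Inf {x. x > 0 \<and> F x > 0}"

text \<open>The set below is nonempty and bounded below for \<open>0 < y < 1\<close> and \<open>F\<close> a distribution
  function; for other \<open>y\<close> the real-valued infimum need not carry any meaning.\<close>

definition quantile :: "(real \<Rightarrow> real) \<Rightarrow> real \<Rightarrow> real" where
  "quantile F y = Inf {x. F x \<ge> y}"

text \<open>At the left endpoint \<open>0\<close> the expression \<open>x powr (-\<alpha>)\<close> has no mathematical meaning, so the
  formula is only required for \<open>x > 0\<close>; this matters only if the left endpoint is \<open>0\<close>.\<close>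

definition regularly_varying_law :: "real \<Rightarrow> (real \<Rightarrow> real) \<Rightarrow> (real \<Rightarrow> real) \<Rightarrow> bool" where
  "regularly_varying_law \<alpha> L F2 \<longleftrightarrow>
     is_cdf F2 \<and>
     (\<forall>x < left_endpoint F2. F2 x = 0) \<and>
     (\<forall>x \<ge> left_endpoint F2. x > 0 \<longrightarrow> F2 x = 1 - x powr (- \<alpha>) * L x) \<and>
     continuous_on {x. x > 0 \<and> x \<ge> left_endpoint F2} L \<and>
     slowly_varying L"

definition condA1 :: "real \<Rightarrow> real \<Rightarrow> (nat \<Rightarrow> nat) \<Rightarrow> (nat \<Rightarrow> real) \<Rightarrow> bool" where
  "condA1 \<tau> \<alpha> k \<epsilon> \<longleftrightarrow>
     (\<exists>\<beta>>\<tau> / \<alpha>. filterlim (\<lambda>n. ln (real (k n)) / (real (k n) * \<epsilon> n) powr \<beta>) at_top sequentially)"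

definition condA2 :: "real \<Rightarrow> real \<Rightarrow> (nat \<Rightarrow> nat) \<Rightarrow> (nat \<Rightarrow> real) \<Rightarrow> bool" where
  "condA2 \<tau> \<alpha> k \<epsilon> \<longleftrightarrow>
     (\<exists>\<beta>. 0 < \<beta> \<and> \<beta> < \<tau> / \<alpha> \<and>
        (\<lambda>n. ln (real (k n)) / (real (k n) * \<epsilon> n) powr \<beta>) \<longlonglongrightarrow> 0)"

definition condA3_with :: "real \<Rightarrow> real \<Rightarrow> (nat \<Rightarrow> nat) \<Rightarrow> (nat \<Rightarrow> real) \<Rightarrow> real \<Rightarrow> bool" where
  "condA3_with \<tau> \<alpha> k \<epsilon> d \<longleftrightarrow>
     d > 0 \<and> (\<forall>n. real (k n) * \<epsilon> n = d * ln (real (k n)) powr (\<alpha> / \<tau>))"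

definition condA3 :: "real \<Rightarrow> real \<Rightarrow> (nat \<Rightarrow> nat) \<Rightarrow> (nat \<Rightarrow> real) \<Rightarrow> bool" where
  "condA3 \<tau> \<alpha> k \<epsilon> \<longleftrightarrow> (\<exists>d. condA3_with \<tau> \<alpha> k \<epsilon> d)"

definition rate_vanishing_or_const :: "(nat \<Rightarrow> nat) \<Rightarrow> (nat \<Rightarrow> real) \<Rightarrow> bool" where
  "rate_vanishing_or_const k \<epsilon> \<longleftrightarrow>
     (\<lambda>n. real (k n) * \<epsilon> n) \<longlonglongrightarrow> 0 \<or> (\<exists>C>0. \<forall>n. real (k n) * \<epsilon> n = C)"

definition rate_divergent_A1 :: "real \<Rightarrow> real \<Rightarrow> (nat \<Rightarrow> nat) \<Rightarrow> (nat \<Rightarrow> real) \<Rightarrow> bool" where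
  "rate_divergent_A1 \<tau> \<alpha> k \<epsilon> \<longleftrightarrow>
     filterlim (\<lambda>n. real (k n) * \<epsilon> n) at_top sequentially \<and> condA1 \<tau> \<alpha> k \<epsilon>"

text \<open>The rates the classification speaks about. They do not exhaust all sequences: if
  \<open>k n * \<epsilon> n\<close> alternates between \<open>1\<close> and \<open>sqrt (k n)\<close>, two subsequences have limit laws of
  different types and no normalisation yields a non-degenerate limit; if it alternates
  between \<open>1\<close> and \<open>2\<close>, the limit is Gumbel although none of the conditions holds.\<close>

definition rate_regime :: "real \<Rightarrow> real \<Rightarrow> (nat \<Rightarrow> nat) \<Rightarrow> (nat \<Rightarrow> real) \<Rightarrow> bool" where
  "rate_regime \<tau> \<alpha> k \<epsilon> \<longleftrightarrow>
     rate_vanishing_or_const k \<epsilon> \<or> rate_divergent_A1 \<tau> \<alpha> k \<epsilon> \<or> condA2 \<tau> \<alpha> k \<epsilon> \<or> condA3 \<tau> \<alpha> k \<epsilon>"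

definition gumbel_condition ::
  "real \<Rightarrow> real \<Rightarrow> (real \<Rightarrow> real) \<Rightarrow> (nat \<Rightarrow> nat) \<Rightarrow> (nat \<Rightarrow> real) \<Rightarrow> bool" where
  "gumbel_condition \<tau> \<alpha> L k \<epsilon> \<longleftrightarrow>
     rate_vanishing_or_const k \<epsilon> \<or>
     rate_divergent_A1 \<tau> \<alpha> k \<epsilon> \<or>
     (condA3 \<tau> \<alpha> k \<epsilon> \<and> (L \<longlongrightarrow> 0) at_top)"

definition frechet_condition ::
  "real \<Rightarrow> real \<Rightarrow> (real \<Rightarrow> real) \<Rightarrow> (nat \<Rightarrow> nat) \<Rightarrow> (nat \<Rightarrow> real) \<Rightarrow> bool" where
  "frechet_condition \<tau> \<alpha> L k \<epsilon> \<longleftrightarrow>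
     condA2 \<tau> \<alpha> k \<epsilon> \<or>
     (condA3 \<tau> \<alpha> k \<epsilon> \<and> filterlim L at_top at_top)"

definition discontinuous_condition ::
  "real \<Rightarrow> real \<Rightarrow> (real \<Rightarrow> real) \<Rightarrow> (nat \<Rightarrow> nat) \<Rightarrow> (nat \<Rightarrow> real) \<Rightarrow> real \<Rightarrow> real \<Rightarrow> bool" where
  "discontinuous_condition \<tau> \<alpha> L k \<epsilon> d l \<longleftrightarrow>
     condA3_with \<tau> \<alpha> k \<epsilon> d \<and> l > 0 \<and> (L \<longlongrightarrow> l) at_top"

definition gumbel_cdf :: "real \<Rightarrow> real" where
  "gumbel_cdf x = exp (- exp (- x))"

definition frechet_cdf :: "real \<Rightarrow> real \<Rightarrow> real" where
  "frechet_cdf \<alpha> x = (if x \<le> 0 then 0 else exp (- (x powr (- \<alpha>))))"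

definition jump_point :: "real \<Rightarrow> real \<Rightarrow> real \<Rightarrow> real \<Rightarrow> real \<Rightarrow> real" where
  "jump_point lam \<tau> \<alpha> d l = lam powr (- 1 / \<tau>) * (d * l) powr (- 1 / \<alpha>)"

text \<open>This function is not right-continuous: its value at the jump lies strictly between the
  one-sided limits. It occurs as a pointwise limit of distribution functions under a
  suitable normalisation.\<close>

definition discontinuous_law ::
  "real \<Rightarrow> real \<Rightarrow> real \<Rightarrow> real \<Rightarrow> real \<Rightarrow> real \<Rightarrow> real" where
  "discontinuous_law lam \<tau> \<alpha> d l x =
     (if x < jump_point lam \<tau> \<alpha> d l then 0
      else if x = jump_point lam \<tau> \<alpha> d l then exp (- (1 + x powr (- \<alpha>)))
      else exp (- (x powr (- \<alpha>))))"

definition same_type :: "(real \<Rightarrow> real) \<Rightarrow> (real \<Rightarrow> real) \<Rightarrow> bool" where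
  "same_type H G \<longleftrightarrow> (\<exists>a>0. \<exists>b. \<forall>x. H x = G (a * x + b))"

text \<open>The same up to the value at the point that is mapped to \<open>p\<close>. This is needed because the
  value of a pointwise limit at a jump depends on the normalisation and not only on its type.\<close>

definition same_type_off :: "real \<Rightarrow> (real \<Rightarrow> real) \<Rightarrow> (real \<Rightarrow> real) \<Rightarrow> bool" where
  "same_type_off p H G \<longleftrightarrow> (\<exists>a>0. \<exists>b. \<forall>x. a * x + b \<noteq> p \<longrightarrow> H x = G (a * x + b))"

text \<open>Distribution functions of laws other than point masses. Right-continuity is deliberately
  not required, so that \<open>discontinuous_law\<close> is covered; accordingly a point mass may take any
  value at its atom.\<close>

definition nondegenerate_law :: "(real \<Rightarrow> real) \<Rightarrow> bool" where
  "nondegenerate_law H \<longleftrightarrow>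
     mono H \<and> (H \<longlongrightarrow> 0) at_bot \<and> (H \<longlongrightarrow> 1) at_top \<and>
     \<not> (\<exists>a. (\<forall>x<a. H x = 0) \<and> (\<forall>x>a. H x = 1))"

definition max_prob ::
  "'w measure \<Rightarrow> (nat \<Rightarrow> nat \<Rightarrow> 'w \<Rightarrow> real) \<Rightarrow> (nat \<Rightarrow> nat) \<Rightarrow> nat \<Rightarrow> real \<Rightarrow> real" where
  "max_prob M X k n u = measure M {\<omega> \<in> space M. Max ((\<lambda>j. X n j \<omega>) ` {1..k n}) \<le> u}"

text \<open>Positivity of the scaling is only required for large \<open>n\<close>, since the explicit sequences in
  the theorem can be zero or undefined for finitely many \<open>n\<close> (e.g. if \<open>k n = 1\<close>).\<close>

definition max_limit ::
  "'w measure \<Rightarrow> (nat \<Rightarrow> nat \<Rightarrow> 'w \<Rightarrow> real) \<Rightarrow> (nat \<Rightarrow> nat) \<Rightarrow>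
   (nat \<Rightarrow> real) \<Rightarrow> (nat \<Rightarrow> real) \<Rightarrow> (real \<Rightarrow> real) \<Rightarrow> bool" where
  "max_limit M X k s c H \<longleftrightarrow>
     (\<forall>\<^sub>F n in sequentially. s n > 0) \<and>
     (\<forall>x. (\<lambda>n. max_prob M X k n (s n * x + c n)) \<longlonglongrightarrow> H x)"

definition gumbel_scale :: "real \<Rightarrow> real \<Rightarrow> (nat \<Rightarrow> nat) \<Rightarrow> nat \<Rightarrow> real" where
  "gumbel_scale lam \<tau> k n = inverse (lam * \<tau>) * (inverse lam * ln (real (k n))) powr (1 / \<tau> - 1)"

definition gumbel_centre :: "real \<Rightarrow> real \<Rightarrow> (nat \<Rightarrow> nat) \<Rightarrow> nat \<Rightarrow> real" where
  "gumbel_centre lam \<tau> k n = (inverse lam * ln (real (k n))) powr (1 / \<tau>)"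

definition frechet_scale ::
  "(real \<Rightarrow> real) \<Rightarrow> (nat \<Rightarrow> nat) \<Rightarrow> (nat \<Rightarrow> real) \<Rightarrow> nat \<Rightarrow> real" where
  "frechet_scale F2 k \<epsilon> n = quantile F2 (1 - inverse (real (k n) * \<epsilon> n))"

end

theory Submission
  imports Defs "HOL-Real_Asymp.Real_Asymp"
begin

text \<open>
  The maximum has distribution function \<open>F(\<cdot>; \<epsilon> n) ^ k n\<close>, and \<open>(1 - p n) ^ k n\<close> tends to \<open>exp (- v)\<close>
  when \<open>k n * p n\<close> tends to \<open>v\<close>. So the limit is determined by the Weibull part
  \<open>exp (ln (k n) - lam * u n powr \<tau>)\<close> and the heavy part \<open>k n * \<epsilon> n * (1 - F2 (u n))\<close>. In the Gumbel
  regime the heavy part vanishes under the Weibull normalisation, in the Frechet regime the Weibull part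
  vanishes under the heavy normalisation. Under (A3) with \<open>L\<close> tending to a positive constant both live
  on the same scale: the heavy part has a limit while the Weibull part jumps from infinity to zero at a
  single point.
\<close>

subsection \<open>Maxima and powers\<close>

text \<open>The obstacle is the jump in the discontinuous regime. There the Weibull part at
  \<open>s n * x\<close> is \<open>exp (T n * e n)\<close> with \<open>T n = ln (k n)\<close> and
  \<open>e n\<close> convergent. Off the jump point the limit of \<open>e n\<close> is nonzero and
  its sign settles everything; at the jump point it is zero, and the behaviour of
  \<open>T n * e n\<close> depends on how fast \<open>s n powr \<tau> / T n\<close> converges. For
  the quantile scale that speed is the speed of \<open>L\<close> towards its limit, about which
  nothing is assumed. Convergence at the jump is therefore proved for another scale, proportional to
  \<open>ln (k n) powr (1 / \<tau>)\<close>, and for the quantile scale under a rate condition on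
  \<open>L\<close>. For the same reason uniqueness of type in this regime is stated up to the value
  at one point. The converse implications are not read off the rates. Each condition produces a
  limit of its own type, every other nondegenerate limit has that type, and the three types exclude
  one another.\<close>

lemma max_prob_eq_power:
  assumes "prob_space M" and "k n \<ge> 1"
    and indep: "prob_space.indep_vars M (\<lambda>_. borel) (X n) {1..k n}"
    and cdf: "\<And>j. j \<in> {1..k n} \<Longrightarrow> cdf (distr M borel (X n j)) = F"
  shows "max_prob M X k n u = F u ^ k n"
proof -
  interpret prob_space M by fact
  have meas: "X n j \<in> borel_measurable M" if "j \<in> {1..k n}" for j
    using indep that unfolding indep_vars_def by auto
  have "{\<omega> \<in> space M. Max ((\<lambda>j. X n j \<omega>) ` {1..k n}) \<le> u} =
      (\<Inter>j\<in>{1..k n}. X n j -` {..u} \<inter> space M)"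
    using \<open>k n \<ge> 1\<close> by (auto simp: Max_le_iff)
  then have "max_prob M X k n u = prob (\<Inter>j\<in>{1..k n}. X n j -` {..u} \<inter> space M)"
    by (simp add: max_prob_def)
  also have "\<dots> = (\<Prod>j\<in>{1..k n}. prob (X n j -` {..u} \<inter> space M))"
    using \<open>k n \<ge> 1\<close> by (intro indep_varsD[OF indep]) auto
  also have "\<dots> = (\<Prod>j\<in>{1..k n}. F u)"
  proof (rule prod.cong)
    fix j assume j: "j \<in> {1..k n}"
    have "F u = cdf (distr M borel (X n j)) u" using cdf[OF j] by simp
    also have "\<dots> = prob (X n j -` {..u} \<inter> space M)"
      using meas[OF j] by (simp add: cdf_def measure_distr)
    finally show "prob (X n j -` {..u} \<inter> space M) = F u" ..
  qed simp
  finally show ?thesis by simp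
qed

lemma power_one_minus_le_exp:
  fixes p :: real
  assumes "p \<le> 1"
  shows "(1 - p) ^ m \<le> exp (- (real m * p))"
proof -
  have "(1 - p) ^ m \<le> exp (- p) ^ m"
    using assms exp_ge_add_one_self[of "- p"] by (intro power_mono) auto
  then show ?thesis by (simp add: exp_of_nat_mult[symmetric])
qed

text \<open>Comes from \<open>1 + t \<le> exp t\<close> at \<open>t = p / (1 - p)\<close>, where the
  left side is \<open>1 / (1 - p)\<close>. The extra factor in the exponent tends to
  \<open>1\<close> as \<open>p\<close> vanishes, so this matches the upper bound in the
  limit.\<close>

lemma exp_le_power_one_minus:
  fixes p :: real
  assumes "p < 1"
  shows "exp (- (real m * p / (1 - p))) \<le> (1 - p) ^ m"
proof -
  have "1 / (1 - p) \<le> exp (p / (1 - p))"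
    using assms exp_ge_add_one_self[of "p / (1 - p)"] by (simp add: field_simps)
  then have "exp (- (p / (1 - p))) \<le> 1 - p"
    using assms by (simp add: exp_minus field_simps)
  then have "exp (- (p / (1 - p))) ^ m \<le> (1 - p) ^ m"
    by (intro power_mono) auto
  then show ?thesis by (simp add: exp_of_nat_mult[symmetric])
qed

lemma tendsto_power_one_minus:
  fixes p :: "nat \<Rightarrow> real" and k :: "nat \<Rightarrow> nat"
  assumes k: "filterlim k at_top sequentially"
    and le: "\<And>n. p n \<le> 1"
    and lim: "(\<lambda>n. real (k n) * p n) \<longlonglongrightarrow> v"
  shows "(\<lambda>n. (1 - p n) ^ k n) \<longlonglongrightarrow> exp (- v)"
proof -
  have rk: "filterlim (\<lambda>n. real (k n)) at_top sequentially"
    using filterlim_compose[OF filterlim_real_sequentially k] .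
  \<comment> \<open>Dividing by \<open>k n\<close> shows that \<open>p n\<close> vanishes, which
    makes the denominators \<open>1 - p n\<close> of the lower bound harmless.\<close>
  have "(\<lambda>n. (real (k n) * p n) / real (k n)) \<longlonglongrightarrow> 0"
    by (rule tendsto_divide_0[OF lim filterlim_at_top_imp_at_infinity[OF rk]])
  moreover have "\<forall>\<^sub>F n in sequentially. (real (k n) * p n) / real (k n) = p n"
    using filterlim_at_top_dense[THEN iffD1, OF rk, rule_format, of 0] by eventually_elim simp
  ultimately have p0: "p \<longlonglongrightarrow> 0" using tendsto_cong by fast
  show ?thesis
  proof (rule tendsto_sandwich)
    show "\<forall>\<^sub>F n in sequentially. exp (- (real (k n) * p n / (1 - p n))) \<le> (1 - p n) ^ k n"
      using order_tendstoD(2)[OF p0, of 1] by (auto elim: eventually_mono intro: exp_le_power_one_minus)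
    show "\<forall>\<^sub>F n in sequentially. (1 - p n) ^ k n \<le> exp (- (real (k n) * p n))"
      by (simp add: le power_one_minus_le_exp)
    have "(\<lambda>n. exp (- (real (k n) * p n / (1 - p n)))) \<longlonglongrightarrow> exp (- (v / (1 - 0)))"
      by (intro tendsto_intros lim p0) auto
    then show "(\<lambda>n. exp (- (real (k n) * p n / (1 - p n)))) \<longlonglongrightarrow> exp (- v)" by simp
    show "(\<lambda>n. exp (- (real (k n) * p n))) \<longlonglongrightarrow> exp (- v)"
      by (intro tendsto_intros lim)
  qed
qed

lemma tendsto_power_one_minus_0:
  fixes p :: "nat \<Rightarrow> real" and k :: "nat \<Rightarrow> nat"
  assumes le: "\<And>n. p n \<le> 1"
    and lim: "filterlim (\<lambda>n. real (k n) * p n) at_top sequentially"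
  shows "(\<lambda>n. (1 - p n) ^ k n) \<longlonglongrightarrow> 0"
proof (rule tendsto_sandwich[OF _ _ tendsto_const])
  show "\<forall>\<^sub>F n in sequentially. 0 \<le> (1 - p n) ^ k n" using le by simp
  show "\<forall>\<^sub>F n in sequentially. (1 - p n) ^ k n \<le> exp (- (real (k n) * p n))"
    by (simp add: le power_one_minus_le_exp)
  show "(\<lambda>n. exp (- (real (k n) * p n))) \<longlonglongrightarrow> 0"
    using lim by (intro filterlim_compose[OF exp_at_bot]) (simp add: filterlim_uminus_at_bot)
qed

subsection \<open>Regularly varying tails\<close>

text \<open>Halving the argument carries any \<open>x \<ge> x0\<close> into the base interval from
  \<open>x0\<close> to \<open>2 * x0\<close>, and \<open>h\<close> does not decrease along the way.
  The induction variable \<open>j\<close> bounds the number of halvings.\<close>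

lemma bounded_of_doubling:
  fixes h :: "real \<Rightarrow> real"
  assumes "0 < x0"
    and dbl: "\<And>x. x0 \<le> x \<Longrightarrow> h (2 * x) \<le> h x"
    and base: "\<And>x. x0 \<le> x \<Longrightarrow> x \<le> 2 * x0 \<Longrightarrow> h x \<le> C"
    and "x0 \<le> x"
  shows "h x \<le> C"
proof -
  have *: "h x \<le> C" if "x0 \<le> x" "x \<le> 2 ^ j * x0" for j x
    using that
  proof (induction j arbitrary: x)
    case 0
    then show ?case using base[of x] \<open>0 < x0\<close> by simp
  next
    case (Suc j)
    show ?case
    proof (cases "x \<le> 2 * x0")
      case False
      then have "h (2 * (x / 2)) \<le> h (x / 2)" by (intro dbl) simp
      also have "\<dots> \<le> C" using False Suc.prems by (intro Suc.IH) auto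
      finally show ?thesis by simp
    qed (use base Suc in auto)
  qed
  obtain j where "x / x0 < 2 ^ j" using real_arch_pow[of 2] by auto
  then show ?thesis using *[of x j] \<open>0 < x0\<close> \<open>x0 \<le> x\<close> by (simp add: field_simps)
qed

text \<open>Since the tail is monotone, Potter's bounds follow by iterating its behaviour under
  doubling of the argument; no uniform convergence theorem is needed.\<close>

locale regularly_varying_tail =
  fixes g :: "real \<Rightarrow> real" and \<alpha> :: real
  assumes antimono_tail: "antimono g"
    and tail_le_1: "g x \<le> 1"
    and tail_pos: "g x > 0"
    and tail_ratio: "t > 0 \<Longrightarrow> ((\<lambda>x. g (t * x) / g x) \<longlongrightarrow> t powr (- \<alpha>)) at_top"
begin

lemma potter_upper:
  assumes "\<delta> > 0"
  obtains C where "C > 0" "\<forall>\<^sub>F x in at_top. g x \<le> C * x powr (\<delta> - \<alpha>)"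
proof -
  have "\<forall>\<^sub>F x in at_top. g (2 * x) / g x < 2 powr (\<delta> - \<alpha>)"
    using assms by (intro order_tendstoD(2)[OF tail_ratio]) auto
  then obtain x1 where x1: "\<And>x. x \<ge> x1 \<Longrightarrow> g (2 * x) / g x < 2 powr (\<delta> - \<alpha>)"
    by (auto simp: eventually_at_top_linorder)
  define x0 where "x0 = max 1 x1"
  \<comment> \<open>The doubling ratio tends to \<open>2 powr (- \<alpha>)\<close>; the slack factor
    \<open>2 powr \<delta>\<close> makes this weighted tail eventually nonincreasing under
    doubling.\<close>
  define h where "h = (\<lambda>x. g x * x powr (\<alpha> - \<delta>))"
  \<comment> \<open>On the base interval \<open>g\<close> is at most \<open>1\<close>; the absolute
    value covers both signs of the exponent.\<close>
  define C where "C = (2 * x0) powr \<bar>\<alpha> - \<delta>\<bar>"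
  have x0: "x0 \<ge> 1" "x0 \<ge> x1" by (auto simp: x0_def)
  have "h x \<le> C" if "x0 \<le> x" for x
  proof (rule bounded_of_doubling[OF _ _ _ that])
    show "0 < x0" using x0 by simp
    fix y assume y: "x0 \<le> y"
    have "g (2 * y) \<le> 2 powr (\<delta> - \<alpha>) * g y"
      using x1[of y] y x0 tail_pos[of y] by (simp add: field_simps)
    then have "h (2 * y) \<le> (2 powr (\<delta> - \<alpha>) * g y) * (2 * y) powr (\<alpha> - \<delta>)"
      unfolding h_def by (intro mult_right_mono) auto
    also have "\<dots> = (2 powr (\<delta> - \<alpha>) * 2 powr (\<alpha> - \<delta>)) * h y"
      using y x0 by (simp add: h_def powr_mult)
    also have "2 powr (\<delta> - \<alpha>) * 2 powr (\<alpha> - \<delta>) = (1::real)"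
      by (simp add: powr_add[symmetric])
    finally show "h (2 * y) \<le> h y" by simp
  next
    fix y assume y: "x0 \<le> y" "y \<le> 2 * x0"
    have "h y \<le> 1 * y powr \<bar>\<alpha> - \<delta>\<bar>"
      unfolding h_def using y x0 tail_le_1[of y] tail_pos[of y]
      by (intro mult_mono powr_mono) auto
    also have "\<dots> \<le> C"
      unfolding C_def using y x0 by (auto intro!: powr_mono2)
    finally show "h y \<le> C" .
  qed
  then have "\<forall>\<^sub>F x in at_top. g x \<le> C * x powr (\<delta> - \<alpha>)"
    unfolding eventually_at_top_linorder
  proof (intro exI[of _ x0] allI impI)
    fix x assume x: "x0 \<le> x" and "\<And>x. x0 \<le> x \<Longrightarrow> h x \<le> C"
    then have "h x * x powr (\<delta> - \<alpha>) \<le> C * x powr (\<delta> - \<alpha>)"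
      by (intro mult_right_mono) auto
    moreover have "h x * x powr (\<delta> - \<alpha>) = g x"
      using x x0 by (simp add: h_def powr_add[symmetric] mult.assoc)
    ultimately show "g x \<le> C * x powr (\<delta> - \<alpha>)" by simp
  qed
  moreover have "C > 0" using x0 by (simp add: C_def)
  ultimately show ?thesis using that by blast
qed

lemma potter_lower:
  assumes "\<delta> > 0" "\<alpha> > 0"
  obtains C where "C > 0" "\<forall>\<^sub>F x in at_top. C * x powr (- (\<alpha> + \<delta>)) \<le> g x"
proof -
  have "\<forall>\<^sub>F x in at_top. g (2 * x) / g x > 2 powr (- (\<alpha> + \<delta>))"
    using assms by (intro order_tendstoD(1)[OF tail_ratio]) auto
  then obtain x1 where x1: "\<And>x. x \<ge> x1 \<Longrightarrow> g (2 * x) / g x > 2 powr (- (\<alpha> + \<delta>))"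
    by (auto simp: eventually_at_top_linorder)
  define x0 where "x0 = max 1 x1"
  \<comment> \<open>The sign turns the lower bound into an upper bound, so that the same doubling
    lemma applies.\<close>
  define h where "h = (\<lambda>x. - (g x * x powr (\<alpha> + \<delta>)))"
  \<comment> \<open>The smallest value of the antitone tail on the base interval, where the power is
    at least \<open>1\<close> because \<open>x0 \<ge> 1\<close>.\<close>
  define C where "C = g (2 * x0)"
  have x0: "x0 \<ge> 1" "x0 \<ge> x1" by (auto simp: x0_def)
  have "h x \<le> - C" if "x0 \<le> x" for x
  proof (rule bounded_of_doubling[OF _ _ _ that])
    show "0 < x0" using x0 by simp
    fix y assume y: "x0 \<le> y"
    have "2 powr (- (\<alpha> + \<delta>)) * g y \<le> g (2 * y)"
      using x1[of y] y x0 tail_pos[of y] by (simp add: field_simps)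
    then have "(2 powr (- (\<alpha> + \<delta>)) * g y) * (2 * y) powr (\<alpha> + \<delta>) \<le> - h (2 * y)"
      unfolding h_def minus_minus by (intro mult_right_mono) auto
    moreover have "(2 powr (- (\<alpha> + \<delta>)) * g y) * (2 * y) powr (\<alpha> + \<delta>) =
        (2 powr (- (\<alpha> + \<delta>)) * 2 powr (\<alpha> + \<delta>)) * (- h y)"
      using y x0 by (simp add: h_def powr_mult)
    moreover have "2 powr (- (\<alpha> + \<delta>)) * 2 powr (\<alpha> + \<delta>) = (1::real)"
      by (simp add: powr_add[symmetric])
    ultimately show "h (2 * y) \<le> h y" by simp
  next
    fix y assume y: "x0 \<le> y" "y \<le> 2 * x0"
    have "C * 1 \<le> g y * y powr (\<alpha> + \<delta>)"
      unfolding C_def using y x0 antimono_tail[THEN antimonoD, of y "2 * x0"] tail_pos[of y] assms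
      by (intro mult_mono ge_one_powr_ge_zero) auto
    then show "h y \<le> - C" by (simp add: h_def)
  qed
  then have "\<forall>\<^sub>F x in at_top. C * x powr (- (\<alpha> + \<delta>)) \<le> g x"
    unfolding eventually_at_top_linorder
  proof (intro exI[of _ x0] allI impI)
    fix x assume x: "x0 \<le> x" and "\<And>x. x0 \<le> x \<Longrightarrow> h x \<le> - C"
    then have "C \<le> - h x" by force
    then have "C * x powr (- (\<alpha> + \<delta>)) \<le> - h x * x powr (- (\<alpha> + \<delta>))"
      by (intro mult_right_mono) auto
    moreover have "- h x * x powr (- (\<alpha> + \<delta>)) = g x * (x powr (\<alpha> + \<delta>) * x powr (- (\<alpha> + \<delta>)))"
      by (simp add: h_def)
    moreover have "x powr (\<alpha> + \<delta>) * x powr (- (\<alpha> + \<delta>)) = 1"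
      using x x0 by (simp only: powr_add[symmetric]) simp
    ultimately show "C * x powr (- (\<alpha> + \<delta>)) \<le> g x" by simp
  qed
  moreover have "C > 0" by (simp add: C_def tail_pos)
  ultimately show ?thesis using that by blast
qed

end

text \<open>First-order expansion: \<open>(1 + x / (\<tau> * T)) powr \<tau>\<close> is
  \<open>1 + x / T\<close> up to lower order. With \<open>T = ln (k n)\<close> this is the Weibull
  exponent under the Gumbel normalisation, and it explains the constants there.\<close>

lemma gumbel_exponent_tendsto:
  fixes x \<tau> :: real
  assumes "\<tau> > 0"
  shows "((\<lambda>T. T - T * (1 + x / (\<tau> * T)) powr \<tau>) \<longlongrightarrow> - x) at_top"
  using assms by real_asymp

subsection \<open>Convergence of types\<close>

lemma nondegenerate_law_bounds:
  assumes "nondegenerate_law H"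
  shows "0 \<le> H x" "H x \<le> 1"
proof -
  have m: "mono H" and 0: "(H \<longlongrightarrow> 0) at_bot" and 1: "(H \<longlongrightarrow> 1) at_top"
    using assms by (auto simp: nondegenerate_law_def)
  show "0 \<le> H x"
    by (rule tendsto_upperbound[OF 0])
      (auto simp: eventually_at_bot_linorder intro!: exI[of _ x] monoD[OF m])
  show "H x \<le> 1"
    by (rule tendsto_lowerbound[OF 1])
      (auto simp: eventually_at_top_linorder intro!: exI[of _ x] monoD[OF m])
qed

text \<open>Two points are wanted because two values determine an affine map. With no value strictly
  inside the unit interval \<open>H\<close> would be a step function; with only one such point it
  would still be a point mass, as \<open>nondegenerate_law\<close> ignores the value at the
  atom.\<close>

lemma nondegenerate_law_two_values:
  assumes H: "nondegenerate_law H"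
  obtains x1 x2 where "x1 < x2" "0 < H x1" "H x1 < 1" "0 < H x2" "H x2 < 1"
proof -
  note bnd = nondegenerate_law_bounds[OF H]
  have m: "mono H" and 0: "(H \<longlongrightarrow> 0) at_bot" and 1: "(H \<longlongrightarrow> 1) at_top"
    and nd: "\<nexists>a. (\<forall>x<a. H x = 0) \<and> (\<forall>x>a. H x = 1)"
    using H by (auto simp: nondegenerate_law_def)
  have "\<exists>x. 0 < H x \<and> H x < 1"
  proof (rule ccontr)
    assume "\<not> ?thesis"
    then have 01: "H x = 0 \<or> H x = 1" for x
      using bnd(1)[of x] bnd(2)[of x] by (metis order.not_eq_order_implies_strict)
    \<comment> \<open>If \<open>H\<close> took only the values \<open>0\<close> and
      \<open>1\<close>, the supremum of this set would be an atom carrying all the mass.\<close>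
    define S where "S = {x. H x = 0}"
    have "\<forall>\<^sub>F x in at_bot. H x < 1" using order_tendstoD(2)[OF 0] by simp
    then obtain x0 where "H x0 < 1" by (auto simp: eventually_at_bot_linorder)
    then have ne: "S \<noteq> {}" using 01[of x0] by (auto simp: S_def)
    have "\<forall>\<^sub>F x in at_top. H x > 0" using order_tendstoD(1)[OF 1] by simp
    then obtain x1 where "H x1 > 0" by (auto simp: eventually_at_top_linorder)
    then have bdd: "x \<le> x1" if "x \<in> S" for x
      using that monoD[OF m, of x1 x] by (cases "x \<le> x1") (auto simp: S_def)
    have "H x = 0" if x: "x < Sup S" for x
    proof -
      obtain z where "z \<in> S" "x < z" using less_cSupE[OF x ne] by blast
      then show ?thesis using monoD[OF m, of x z] bnd(1)[of x] by (auto simp: S_def)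
    qed
    moreover have "H x = 1" if "x > Sup S" for x
      using that 01[of x] cSup_upper[of x S] bdd by (force simp: S_def bdd_above_def)
    ultimately show False using nd by blast
  qed
  then obtain x1 where x1: "0 < H x1" "H x1 < 1" by blast
  have "\<exists>x. x \<noteq> x1 \<and> 0 < H x \<and> H x < 1"
  proof (rule ccontr)
    assume "\<not> ?thesis"
    then have 01: "H x = 0 \<or> H x = 1" if "x \<noteq> x1" for x
      using bnd(1)[of x] bnd(2)[of x] that by (metis order.not_eq_order_implies_strict)
    have "H x = 0" if "x < x1" for x
      using 01[of x] that monoD[OF m, of x x1] x1 by auto
    moreover have "H x = 1" if "x > x1" for x
      using 01[of x] that monoD[OF m, of x1 x] x1 by auto
    ultimately show False using nd by blast
  qed
  then show ?thesis using x1 that by (metis linorder_neqE)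
qed

lemma nondegenerate_lawI:
  assumes "mono H" "(H \<longlongrightarrow> 0) at_bot" "(H \<longlongrightarrow> 1) at_top"
    and "x1 < x2" "0 < H x1" "H x2 < 1"
  shows "nondegenerate_law H"
proof -
  have "H x1 \<le> H x2" using assms by (intro monoD[OF assms(1)]) auto
  have False if *: "\<forall>x<a. H x = 0" "\<forall>x>a. H x = 1" for a
  proof -
    have "\<not> x1 < a" using *(1) assms by auto
    moreover have "\<not> x2 > a" using *(2) assms by auto
    ultimately show False using assms by simp
  qed
  then show ?thesis using assms by (auto simp: nondegenerate_law_def)
qed

text \<open>Khinchin's theorem. The pseudo-inverse hypothesis forces the renormalised arguments
  \<open>A n * x + B n\<close> to converge at two points \<open>x\<close>. The limiting slope cannot vanish:
  otherwise \<open>H\<close> would be bounded by a value of \<open>G\<close>, hence away from \<open>1\<close>. This also excludes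
  zooming in on a jump of \<open>G\<close>.\<close>

lemma convergence_of_types:
  fixes P :: "nat \<Rightarrow> real \<Rightarrow> real"
  assumes mono: "\<And>n. mono (P n)"
    and \<sigma>: "\<forall>\<^sub>F n in sequentially. \<sigma> n > 0"
    and limG: "\<And>y. (\<lambda>n. P n (\<sigma> n * y + \<gamma> n)) \<longlonglongrightarrow> G y"
    and G_less_1: "\<And>y. G y < 1"
    and pseudo_inv: "\<And>p. 0 < p \<Longrightarrow> p < 1 \<Longrightarrow> \<exists>y. (\<forall>z<y. G z < p) \<and> (\<forall>z>y. p < G z)"
    and s: "\<forall>\<^sub>F n in sequentially. s n > 0"
    and limH: "\<And>x. (\<lambda>n. P n (s n * x + c n)) \<longlonglongrightarrow> H x"
    and H: "nondegenerate_law H"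
  obtains a b where "a > 0" "\<And>x. isCont G (a * x + b) \<Longrightarrow> H x = G (a * x + b)"
proof -
  \<comment> \<open>Change to the reference coordinates:
    \<open>s n * x + c n = \<sigma> n * (A n * x + B n) + \<gamma> n\<close> for large
    \<open>n\<close>.\<close>
  define A where "A = (\<lambda>n. s n / \<sigma> n)"
  define B where "B = (\<lambda>n. (c n - \<gamma> n) / \<sigma> n)"
  \<comment> \<open>A strict inequality between the limits persists for large \<open>n\<close>, and
    monotonicity of \<open>P n\<close> turns it into one between the arguments.\<close>
  have gt: "\<forall>\<^sub>F n in sequentially. z < A n * x + B n" if "G z < H x" for x z
  proof -
    have "(\<lambda>n. P n (s n * x + c n) - P n (\<sigma> n * z + \<gamma> n)) \<longlonglongrightarrow> H x - G z"
      by (intro tendsto_diff limH limG)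
    from order_tendstoD(1)[OF this, of 0] that
    have "\<forall>\<^sub>F n in sequentially. P n (s n * x + c n) - P n (\<sigma> n * z + \<gamma> n) > 0" by simp
    with \<sigma> show ?thesis
    proof eventually_elim
      case (elim n)
      then have "\<not> s n * x + c n \<le> \<sigma> n * z + \<gamma> n" using monoD[OF mono] by (auto simp: not_le[symmetric])
      then show ?case using elim by (simp add: A_def B_def field_simps)
    qed
  qed
  have lt: "\<forall>\<^sub>F n in sequentially. A n * x + B n < z" if "H x < G z" for x z
  proof -
    have "(\<lambda>n. P n (\<sigma> n * z + \<gamma> n) - P n (s n * x + c n)) \<longlonglongrightarrow> G z - H x"
      by (intro tendsto_diff limH limG)
    from order_tendstoD(1)[OF this, of 0] that
    have "\<forall>\<^sub>F n in sequentially. P n (\<sigma> n * z + \<gamma> n) - P n (s n * x + c n) > 0" by simp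
    with \<sigma> show ?thesis
    proof eventually_elim
      case (elim n)
      then have "\<not> \<sigma> n * z + \<gamma> n \<le> s n * x + c n" using monoD[OF mono] by (auto simp: not_le[symmetric])
      then show ?case using elim by (simp add: A_def B_def field_simps)
    qed
  qed
  have conv: "\<exists>y. (\<lambda>n. A n * x + B n) \<longlonglongrightarrow> y" if x: "0 < H x" "H x < 1" for x
  proof -
    obtain y where "\<forall>z<y. G z < H x" "\<forall>z>y. H x < G z" using pseudo_inv[OF x] by blast
    then have "(\<lambda>n. A n * x + B n) \<longlonglongrightarrow> y" by (intro order_tendstoI gt lt) auto
    then show ?thesis ..
  qed
  obtain x1 x2 where x12: "x1 < x2" "0 < H x1" "H x1 < 1" "0 < H x2" "H x2 < 1"
    using nondegenerate_law_two_values[OF H] .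
  obtain y1 y2 where y: "(\<lambda>n. A n * x1 + B n) \<longlonglongrightarrow> y1" "(\<lambda>n. A n * x2 + B n) \<longlonglongrightarrow> y2"
    using conv x12 by blast
  define a where "a = (y2 - y1) / (x2 - x1)"
  define b where "b = y1 - a * x1"
  have "(\<lambda>n. ((A n * x2 + B n) - (A n * x1 + B n)) / (x2 - x1)) \<longlonglongrightarrow> a"
    unfolding a_def using x12 by (intro tendsto_intros y) auto
  moreover have "(\<lambda>n. ((A n * x2 + B n) - (A n * x1 + B n)) / (x2 - x1)) = A"
    using x12 by (auto simp: field_simps)
  ultimately have A: "A \<longlonglongrightarrow> a" by simp
  have "(\<lambda>n. (A n * x1 + B n) - A n * x1) \<longlonglongrightarrow> b"
    unfolding b_def by (intro tendsto_intros y A)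
  then have B: "B \<longlonglongrightarrow> b" by simp
  have AB: "(\<lambda>n. A n * x + B n) \<longlonglongrightarrow> a * x + b" for x
    by (intro tendsto_intros A B)
  \<comment> \<open>The two bounds \<open>le\<close> and \<open>ge\<close> place \<open>H x\<close>
    between the one-sided limits of \<open>G\<close> at \<open>a * x + b\<close>. At a continuity
    point they determine \<open>H x\<close>; at a jump of \<open>G\<close> they leave its value
    open.\<close>
  have le: "H x \<le> G z" if "a * x + b < z" for x z
  proof (rule ccontr)
    assume "\<not> ?thesis"
    then have "\<forall>\<^sub>F n in sequentially. z < A n * x + B n" by (intro gt) simp
    with order_tendstoD(2)[OF AB that] have "\<forall>\<^sub>F n in sequentially. False"
      by eventually_elim simp
    then show False by simp
  qed
  have ge: "G z \<le> H x" if "z < a * x + b" for x z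
  proof (rule ccontr)
    assume "\<not> ?thesis"
    then have "\<forall>\<^sub>F n in sequentially. A n * x + B n < z" by (intro lt) simp
    with order_tendstoD(1)[OF AB that] have "\<forall>\<^sub>F n in sequentially. False"
      by eventually_elim simp
    then show False by simp
  qed
  have "\<forall>\<^sub>F n in sequentially. 0 \<le> A n"
    using \<sigma> s by eventually_elim (simp add: A_def)
  then have "a \<ge> 0" by (rule tendsto_lowerbound[OF A]) simp
  moreover have "a \<noteq> 0"
  proof
    assume "a = 0"
    then have "H x \<le> G (b + 1)" for x using le[of x "b + 1"] by simp
    then have "1 \<le> G (b + 1)"
      using H by (intro tendsto_upperbound[of H _ at_top]) (auto simp: nondegenerate_law_def)
    then show False using G_less_1[of "b + 1"] by simp
  qed
  ultimately have "a > 0" by simp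
  moreover have "H x = G (a * x + b)" if "isCont G (a * x + b)" for x
  proof (rule antisym)
    have lim: "(G \<longlongrightarrow> G (a * x + b)) (at (a * x + b))" using that by (simp add: isCont_def)
    show "H x \<le> G (a * x + b)"
      by (rule tendsto_lowerbound[OF tendsto_mono[OF at_le[OF subset_UNIV] lim, of "{a * x + b<..}"]])
        (auto simp: eventually_at_filter intro!: always_eventually le)
    show "G (a * x + b) \<le> H x"
      by (rule tendsto_upperbound[OF tendsto_mono[OF at_le[OF subset_UNIV] lim, of "{..<a * x + b}"]])
        (auto simp: eventually_at_filter intro!: always_eventually ge)
  qed
  ultimately show ?thesis using that by blast
qed

subsection \<open>The limit laws\<close>

lemma gumbel_cdf_pseudo_inverse:
  assumes "0 < p" "p < 1"
  shows "\<exists>y. (\<forall>z<y. gumbel_cdf z < p) \<and> (\<forall>z>y. p < gumbel_cdf z)"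
proof -
  have "ln p < 0" using assms by simp
  then have "gumbel_cdf (- ln (- ln p)) = p" using assms by (simp add: gumbel_cdf_def)
  moreover have "gumbel_cdf u < gumbel_cdf v" if "u < v" for u v
    using that by (simp add: gumbel_cdf_def)
  ultimately show ?thesis by metis
qed

lemma gumbel_cdf_less_1: "gumbel_cdf y < 1"
  by (simp add: gumbel_cdf_def)

lemma isCont_gumbel_cdf: "isCont gumbel_cdf y"
  unfolding gumbel_cdf_def by (intro continuous_intros)

lemma nondegenerate_gumbel_cdf: "nondegenerate_law gumbel_cdf"
proof (rule nondegenerate_lawI[of _ 0 1])
  show "mono gumbel_cdf" by (auto simp: mono_def gumbel_cdf_def)
  show "(gumbel_cdf \<longlongrightarrow> 0) at_bot" "(gumbel_cdf \<longlongrightarrow> 1) at_top"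
    unfolding gumbel_cdf_def by real_asymp+
qed (auto simp: gumbel_cdf_def)

section \<open>The Frechet law\<close>

lemma frechet_cdf_strict_mono:
  assumes "\<alpha> > 0" "0 < u" "u < v"
  shows "frechet_cdf \<alpha> u < frechet_cdf \<alpha> v"
  using assms by (auto simp: frechet_cdf_def intro!: powr_less_mono2_neg)

lemma frechet_cdf_pos: "x > 0 \<Longrightarrow> frechet_cdf \<alpha> x > 0"
  by (simp add: frechet_cdf_def)

lemma frechet_cdf_less_1: "frechet_cdf \<alpha> y < 1"
  by (auto simp: frechet_cdf_def)

lemma frechet_cdf_at_inverse:
  assumes "\<alpha> > 0" "0 < p" "p < 1"
  shows "(- ln p) powr (- 1 / \<alpha>) > 0" "frechet_cdf \<alpha> ((- ln p) powr (- 1 / \<alpha>)) = p"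
proof -
  have "ln p < 0" using assms by simp
  then show "(- ln p) powr (- 1 / \<alpha>) > 0" "frechet_cdf \<alpha> ((- ln p) powr (- 1 / \<alpha>)) = p"
    using assms by (auto simp: frechet_cdf_def powr_powr not_le)
qed

lemma frechet_cdf_pseudo_inverse:
  assumes "\<alpha> > 0" "0 < p" "p < 1"
  shows "\<exists>y>0. (\<forall>z<y. frechet_cdf \<alpha> z < p) \<and> (\<forall>z>y. p < frechet_cdf \<alpha> z)"
proof (intro exI conjI allI impI)
  let ?y = "(- ln p) powr (- 1 / \<alpha>)"
  note y = frechet_cdf_at_inverse[OF assms]
  show "?y > 0" using y(1) .
  show "frechet_cdf \<alpha> z < p" if "z < ?y" for z
  proof (cases "z > 0")
    case True
    then show ?thesis using frechet_cdf_strict_mono[OF assms(1) _ that] y by simp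
  qed (use assms in \<open>simp add: frechet_cdf_def\<close>)
  show "p < frechet_cdf \<alpha> z" if "z > ?y" for z
    using frechet_cdf_strict_mono[OF assms(1) y(1) that] y by simp
qed

lemma mono_frechet_cdf: "\<alpha> > 0 \<Longrightarrow> mono (frechet_cdf \<alpha>)"
  using frechet_cdf_strict_mono[of \<alpha>]
  by (intro monoI) (force simp: frechet_cdf_def intro: powr_mono2')

lemma frechet_cdf_at_bot: "(frechet_cdf \<alpha> \<longlongrightarrow> 0) at_bot"
  by (rule tendsto_eventually)
    (auto simp: eventually_at_bot_linorder frechet_cdf_def intro!: exI[of _ 0])

lemma frechet_cdf_at_top:
  assumes "\<alpha> > 0"
  shows "(frechet_cdf \<alpha> \<longlongrightarrow> 1) at_top"
proof -
  have "((\<lambda>x. exp (- (x powr (- \<alpha>)))) \<longlongrightarrow> 1) at_top"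
    using assms by real_asymp
  moreover have "\<forall>\<^sub>F x in at_top. exp (- (x powr (- \<alpha>))) = frechet_cdf \<alpha> x"
    using eventually_gt_at_top[of 0] by eventually_elim (simp add: frechet_cdf_def)
  ultimately show ?thesis using tendsto_cong by fast
qed

lemma isCont_frechet_cdf:
  assumes "\<alpha> > 0"
  shows "isCont (frechet_cdf \<alpha>) y"
proof -
  consider "y < 0" | "y > 0" | "y = 0" by linarith
  then show ?thesis
  proof cases
    case 1
    have "\<forall>\<^sub>F x in nhds y. frechet_cdf \<alpha> x = 0"
      using eventually_nhds_in_open[of "{..<0}" y] 1
      by (auto elim!: eventually_mono simp: frechet_cdf_def)
    then show ?thesis using isCont_cong[of "frechet_cdf \<alpha>" "\<lambda>_. 0" y] by simp
  next
    case 2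
    have "\<forall>\<^sub>F x in nhds y. frechet_cdf \<alpha> x = exp (- (x powr (- \<alpha>)))"
      using eventually_nhds_in_open[of "{0<..}" y] 2
      by (auto elim!: eventually_mono simp: frechet_cdf_def)
    moreover have "isCont (\<lambda>x. exp (- (x powr (- \<alpha>)))) y"
      using 2 by (intro continuous_intros) auto
    ultimately show ?thesis using isCont_cong by fast
  next
    case 3
    \<comment> \<open>The two branches meet continuously at \<open>0\<close> because the exponent
      tends to minus infinity from the right.\<close>
    have "((\<lambda>x. exp (- (x powr (- \<alpha>)))) \<longlongrightarrow> 0) (at_right 0)"
      using assms by real_asymp
    moreover have "\<forall>\<^sub>F x in at_right 0. exp (- (x powr (- \<alpha>))) = frechet_cdf \<alpha> x"
      by (auto simp: eventually_at_filter frechet_cdf_def)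
    ultimately have "(frechet_cdf \<alpha> \<longlongrightarrow> 0) (at_right 0)" using tendsto_cong by fast
    moreover have "(frechet_cdf \<alpha> \<longlongrightarrow> 0) (at_left 0)"
      by (rule tendsto_eventually) (auto simp: eventually_at_filter frechet_cdf_def)
    ultimately show ?thesis
      using 3 by (simp add: isCont_def filterlim_split_at frechet_cdf_def)
  qed
qed

lemma nondegenerate_frechet_cdf: "\<alpha> > 0 \<Longrightarrow> nondegenerate_law (frechet_cdf \<alpha>)"
  by (rule nondegenerate_lawI[of _ 1 2])
    (auto simp: mono_frechet_cdf frechet_cdf_at_bot frechet_cdf_at_top frechet_cdf_pos
       frechet_cdf_less_1)

section \<open>The discontinuous law\<close>

lemma discontinuous_law_below: "x < jump_point lam \<tau> \<alpha> d l \<Longrightarrow> discontinuous_law lam \<tau> \<alpha> d l x = 0"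
  by (simp add: discontinuous_law_def)

context
  fixes lam \<tau> \<alpha> d l :: real
  assumes pos: "lam > 0" "\<alpha> > 0" "d > 0" "l > 0"
begin

lemma jump_point_pos: "jump_point lam \<tau> \<alpha> d l > 0"
  using pos by (simp add: jump_point_def)

lemma discontinuous_law_above:
  "x > jump_point lam \<tau> \<alpha> d l \<Longrightarrow> discontinuous_law lam \<tau> \<alpha> d l x = frechet_cdf \<alpha> x"
  using jump_point_pos by (auto simp: discontinuous_law_def frechet_cdf_def)

text \<open>At the jump the Weibull part has limit \<open>1\<close>, which accounts for the factor
  \<open>exp (- 1)\<close>; the heavy part supplies the Frechet value.\<close>

lemma discontinuous_law_at:
  "x = jump_point lam \<tau> \<alpha> d l \<Longrightarrow> discontinuous_law lam \<tau> \<alpha> d l x = exp (- 1) * frechet_cdf \<alpha> x"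
  using jump_point_pos by (auto simp: discontinuous_law_def frechet_cdf_def exp_add[symmetric])

lemma discontinuous_law_bounds:
  "0 \<le> discontinuous_law lam \<tau> \<alpha> d l x" "discontinuous_law lam \<tau> \<alpha> d l x \<le> frechet_cdf \<alpha> x"
proof -
  have *: "0 \<le> frechet_cdf \<alpha> x" by (simp add: frechet_cdf_def)
  consider "x < jump_point lam \<tau> \<alpha> d l" | "x = jump_point lam \<tau> \<alpha> d l" | "x > jump_point lam \<tau> \<alpha> d l"
    by linarith
  then have "0 \<le> discontinuous_law lam \<tau> \<alpha> d l x \<and> discontinuous_law lam \<tau> \<alpha> d l x \<le> frechet_cdf \<alpha> x"
    by cases (use * in \<open>auto simp: discontinuous_law_below discontinuous_law_at
      discontinuous_law_above intro: mult_left_le_one_le\<close>)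
  then show "0 \<le> discontinuous_law lam \<tau> \<alpha> d l x" "discontinuous_law lam \<tau> \<alpha> d l x \<le> frechet_cdf \<alpha> x"
    by auto
qed

lemma discontinuous_law_less_1: "discontinuous_law lam \<tau> \<alpha> d l y < 1"
  using discontinuous_law_bounds(2)[of y] frechet_cdf_less_1[of \<alpha> y] by simp

lemma mono_discontinuous_law: "mono (discontinuous_law lam \<tau> \<alpha> d l)"
proof (rule monoI)
  fix x y :: real assume "x \<le> y"
  consider "y \<le> jump_point lam \<tau> \<alpha> d l" | "y > jump_point lam \<tau> \<alpha> d l" by linarith
  then show "discontinuous_law lam \<tau> \<alpha> d l x \<le> discontinuous_law lam \<tau> \<alpha> d l y"
  proof cases
    case 1
    then show ?thesis
      using \<open>x \<le> y\<close> discontinuous_law_bounds(1)[of y] discontinuous_law_below[of x lam \<tau> \<alpha> d l]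
      by (cases "x = y") auto
  next
    case 2
    have "discontinuous_law lam \<tau> \<alpha> d l x \<le> frechet_cdf \<alpha> x" by (rule discontinuous_law_bounds)
    also have "\<dots> \<le> frechet_cdf \<alpha> y" using mono_frechet_cdf pos \<open>x \<le> y\<close> by (auto dest: monoD)
    finally show ?thesis using 2 by (simp add: discontinuous_law_above)
  qed
qed

lemma discontinuous_law_pseudo_inverse:
  assumes "0 < p" "p < 1"
  shows "\<exists>y. (\<forall>z<y. discontinuous_law lam \<tau> \<alpha> d l z < p) \<and> (\<forall>z>y. p < discontinuous_law lam \<tau> \<alpha> d l z)"
proof -
  let ?j = "jump_point lam \<tau> \<alpha> d l"
  obtain y where y: "\<And>z. z < y \<Longrightarrow> frechet_cdf \<alpha> z < p" "\<And>z. z > y \<Longrightarrow> p < frechet_cdf \<alpha> z"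
    using frechet_cdf_pseudo_inverse[of \<alpha> p] pos assms by blast
  \<comment> \<open>Every level inside the jump is crossed at \<open>?j\<close> itself, hence the
    maximum.\<close>
  have "discontinuous_law lam \<tau> \<alpha> d l z < p" if "z < max y ?j" for z
  proof (cases "z < ?j")
    case False
    then have "z < y" using that by (simp add: less_max_iff_disj)
    then show ?thesis using y(1)[of z] discontinuous_law_bounds(2)[of z] by simp
  qed (use assms in \<open>simp add: discontinuous_law_below\<close>)
  moreover have "p < discontinuous_law lam \<tau> \<alpha> d l z" if "z > max y ?j" for z
    using that y(2)[of z] by (simp add: discontinuous_law_above)
  ultimately show ?thesis by blast
qed

lemma isCont_discontinuous_law:
  assumes "y \<noteq> jump_point lam \<tau> \<alpha> d l"
  shows "isCont (discontinuous_law lam \<tau> \<alpha> d l) y"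
proof -
  let ?j = "jump_point lam \<tau> \<alpha> d l"
  consider "y < ?j" | "y > ?j" using assms by linarith
  then show ?thesis
  proof cases
    case 1
    have "\<forall>\<^sub>F x in nhds y. discontinuous_law lam \<tau> \<alpha> d l x = 0"
      using eventually_nhds_in_open[of "{..<?j}" y] 1
      by (auto elim!: eventually_mono simp: discontinuous_law_below)
    then show ?thesis using isCont_cong[of _ "\<lambda>_. 0" y] by simp
  next
    case 2
    have "\<forall>\<^sub>F x in nhds y. discontinuous_law lam \<tau> \<alpha> d l x = frechet_cdf \<alpha> x"
      using eventually_nhds_in_open[of "{?j<..}" y] 2
      by (auto elim!: eventually_mono simp: discontinuous_law_above)
    then show ?thesis using isCont_cong isCont_frechet_cdf pos by fast
  qed
qed

lemma nondegenerate_discontinuous_law: "nondegenerate_law (discontinuous_law lam \<tau> \<alpha> d l)"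
proof (rule nondegenerate_lawI)
  let ?j = "jump_point lam \<tau> \<alpha> d l"
  show "mono (discontinuous_law lam \<tau> \<alpha> d l)" by (rule mono_discontinuous_law)
  have "\<forall>\<^sub>F x in at_bot. discontinuous_law lam \<tau> \<alpha> d l x = 0"
    using eventually_gt_at_bot[of ?j] by eventually_elim (rule discontinuous_law_below)
  then show "(discontinuous_law lam \<tau> \<alpha> d l \<longlongrightarrow> 0) at_bot" by (rule tendsto_eventually)
  have "\<forall>\<^sub>F x in at_top. frechet_cdf \<alpha> x = discontinuous_law lam \<tau> \<alpha> d l x"
    using eventually_gt_at_top[of ?j] by eventually_elim (rule discontinuous_law_above[symmetric])
  with frechet_cdf_at_top[of \<alpha>] show "(discontinuous_law lam \<tau> \<alpha> d l \<longlongrightarrow> 1) at_top"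
    using pos tendsto_cong by fast
  show "?j < ?j + 1" by simp
  show "discontinuous_law lam \<tau> \<alpha> d l (?j + 1) < 1" by (rule discontinuous_law_less_1)
  show "0 < discontinuous_law lam \<tau> \<alpha> d l ?j"
    using jump_point_pos by (simp add: discontinuous_law_at frechet_cdf_pos)
qed

section \<open>Incompatibility of the three types\<close>

lemma not_same_type_gumbel_discontinuous:
  assumes "same_type_off (jump_point lam \<tau> \<alpha> d l) H (discontinuous_law lam \<tau> \<alpha> d l)"
  shows "\<not> same_type H gumbel_cdf"
proof -
  let ?j = "jump_point lam \<tau> \<alpha> d l"
  obtain a b where a: "a > 0" and H: "\<And>x. a * x + b \<noteq> ?j \<Longrightarrow> H x = discontinuous_law lam \<tau> \<alpha> d l (a * x + b)"
    using assms by (auto simp: same_type_off_def)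
  \<comment> \<open>Any point mapped strictly left of the jump will do: there the discontinuous law
    is \<open>0\<close>, a value that the Gumbel law never takes.\<close>
  have "H ((?j - 1 - b) / a) = 0" using a by (simp add: H discontinuous_law_below)
  moreover have "gumbel_cdf y \<noteq> 0" for y by (simp add: gumbel_cdf_def)
  ultimately show ?thesis by (metis same_type_def)
qed

text \<open>A continuous \<open>H\<close> cannot have left limit \<open>0\<close> and a right limit
  at least the positive Frechet value at the jump. Only one-sided limits enter, since
  \<open>same_type_off\<close> says nothing about the value at the jump.\<close>

lemma not_same_type_frechet_discontinuous:
  assumes "same_type_off (jump_point lam \<tau> \<alpha> d l) H (discontinuous_law lam \<tau> \<alpha> d l)"
  shows "\<not> same_type H (frechet_cdf \<alpha>)"
proof
  let ?j = "jump_point lam \<tau> \<alpha> d l"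
  obtain a b where a: "a > 0" and H: "\<And>x. a * x + b \<noteq> ?j \<Longrightarrow> H x = discontinuous_law lam \<tau> \<alpha> d l (a * x + b)"
    using assms by (auto simp: same_type_off_def)
  assume "same_type H (frechet_cdf \<alpha>)"
  then obtain a' b' where H': "\<And>x. H x = frechet_cdf \<alpha> (a' * x + b')" by (auto simp: same_type_def)
  define x where "x = (?j - b) / a"
  have cont: "isCont H x"
  proof -
    have "isCont (\<lambda>x. frechet_cdf \<alpha> (a' * x + b')) x"
      by (rule isCont_o2[OF _ isCont_frechet_cdf]) (auto simp: pos)
    then show ?thesis by (simp add: H'[abs_def])
  qed
  have "(H \<longlongrightarrow> H x) (at_left x)"
    using cont by (auto simp: isCont_def filterlim_at_split)
  moreover have "\<forall>\<^sub>F y in at_left x. H y = 0"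
    using a by (auto simp: eventually_at_filter x_def H discontinuous_law_below field_simps)
  then have "(H \<longlongrightarrow> 0) (at_left x)" by (rule tendsto_eventually)
  ultimately have "H x = 0" using tendsto_unique[OF trivial_limit_at_left_real] by blast
  moreover have "(H \<longlongrightarrow> H x) (at_right x)"
    using cont by (auto simp: isCont_def filterlim_at_split)
  then have "frechet_cdf \<alpha> ?j \<le> H x"
  proof (rule tendsto_lowerbound)
    show "\<forall>\<^sub>F y in at_right x. frechet_cdf \<alpha> ?j \<le> H y"
      using a monoD[OF mono_frechet_cdf[OF pos(2)]]
      by (auto simp: eventually_at_filter x_def H discontinuous_law_above field_simps)
  qed simp
  ultimately show False using frechet_cdf_pos[OF jump_point_pos, of \<alpha>] by simp
qed

end

lemma not_same_type_gumbel_frechet: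
  assumes "same_type H gumbel_cdf"
  shows "\<not> same_type H (frechet_cdf \<alpha>)"
proof
  assume "same_type H (frechet_cdf \<alpha>)"
  then obtain a b where a: "a > 0" and H: "\<And>x. H x = frechet_cdf \<alpha> (a * x + b)"
    by (auto simp: same_type_def)
  have "H (- b / a) = 0" using a by (simp add: H frechet_cdf_def)
  moreover have "gumbel_cdf y \<noteq> 0" for y by (simp add: gumbel_cdf_def)
  ultimately show False using assms by (metis same_type_def)
qed

text \<open>Transfers a convergence rate through a power: Caratheodory's form of the derivative at
  \<open>1\<close> writes \<open>q n powr \<beta> - 1\<close> as \<open>h (q n) * (q n - 1)\<close>
  with \<open>h\<close> continuous at \<open>1\<close>. It is applied with
  \<open>t n = ln (k n)\<close> and \<open>q n\<close> the quotient of \<open>L\<close> by its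
  limit.\<close>

lemma one_minus_powr_tendsto:
  fixes q t :: "nat \<Rightarrow> real"
  assumes q: "q \<longlonglongrightarrow> 1" and t: "(\<lambda>n. t n * (q n - 1)) \<longlonglongrightarrow> 0"
  shows "(\<lambda>n. t n * (1 - q n powr \<beta>)) \<longlonglongrightarrow> 0"
proof -
  have "((\<lambda>x. x powr \<beta>) has_field_derivative \<beta>) (at 1)"
    by (auto intro!: derivative_eq_intros)
  then obtain h where h: "\<And>z. z powr \<beta> - 1 powr \<beta> = h z * (z - 1)" "isCont h 1"
    by (auto simp: DERIV_caratheodory_within continuous_within)
  have "(\<lambda>n. - (h (q n) * (t n * (q n - 1)))) \<longlonglongrightarrow> - (h 1 * 0)"
    by (intro tendsto_intros t isCont_tendsto_compose[OF h(2) q])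
  moreover have "- (h (q n) * (t n * (q n - 1))) = t n * (1 - q n powr \<beta>)" for n
  proof -
    have "q n powr \<beta> = 1 + h (q n) * (q n - 1)" using h(1)[of "q n"] by simp
    then show ?thesis by (simp only:) (simp add: algebra_simps)
  qed
  ultimately show ?thesis by simp
qed

subsection \<open>Maxima of the mixture\<close>

locale mixture_maxima =
  fixes k :: "nat \<Rightarrow> nat"
    and \<epsilon> :: "nat \<Rightarrow> real"
    and lam \<tau> \<alpha> :: real
    and F2 L :: "real \<Rightarrow> real"
  assumes lam_pos: "lam > 0" and tau_pos: "\<tau> > 0" and alpha_pos: "\<alpha> > 0"
    and k_ge_1: "\<And>n. k n \<ge> 1" and k_at_top: "filterlim k at_top sequentially"
    and eps: "\<And>n. 0 < \<epsilon> n \<and> \<epsilon> n < 1" and eps_lim: "\<epsilon> \<longlonglongrightarrow> 0"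
    and law: "regularly_varying_law \<alpha> L F2"
begin

text \<open>The distribution function of the maximum of row \<open>n\<close>, written without random
  variables, so that the work in this locale is purely analytic.\<close>

definition P :: "nat \<Rightarrow> real \<Rightarrow> real" where
  "P n u = mixture_cdf (\<epsilon> n) (weibull_cdf lam \<tau>) F2 u ^ k n"

abbreviation rate :: "nat \<Rightarrow> real" where "rate n \<equiv> real (k n) * \<epsilon> n"
abbreviation T :: "nat \<Rightarrow> real" where "T n \<equiv> ln (real (k n))"
definition g :: "real \<Rightarrow> real" where "g x = 1 - F2 x"

lemma real_k_at_top: "filterlim (\<lambda>n. real (k n)) at_top sequentially"
  using filterlim_compose[OF filterlim_real_sequentially k_at_top] .

lemma T_at_top: "filterlim T at_top sequentially"
  using filterlim_compose[OF ln_at_top real_k_at_top] .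

lemma T_pos: "\<forall>\<^sub>F n in sequentially. T n > 0"
  using filterlim_at_top_dense[THEN iffD1, OF T_at_top] by blast

lemma k_pos: "\<forall>\<^sub>F n in sequentially. real (k n) > 0"
  using filterlim_at_top_dense[THEN iffD1, OF real_k_at_top] by blast

lemma rate_pos: "rate n > 0"
  using k_ge_1[of n] eps[of n] by simp

lemma F2_cdf: "mono F2" "0 \<le> F2 x" "F2 x \<le> 1" "(F2 \<longlongrightarrow> 1) at_top" "continuous (at_right x) F2"
proof -
  obtain D where D: "real_distribution D" "F2 = cdf D"
    using law by (auto simp: regularly_varying_law_def is_cdf_def)
  interpret D: real_distribution D by fact
  show "mono F2" unfolding D by (intro monoI D.cdf_nondecreasing)
  show "0 \<le> F2 x" "F2 x \<le> 1" "(F2 \<longlongrightarrow> 1) at_top" "continuous (at_right x) F2"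
    unfolding D by (auto simp: D.cdf_nonneg D.cdf_bounded_prob D.cdf_lim_at_top_prob D.cdf_is_right_cont)
qed

lemma left_endpoint_nonneg: "left_endpoint F2 \<ge> 0"
proof -
  have "\<forall>\<^sub>F x in at_top. F2 x > 0"
    using order_tendstoD(1)[OF F2_cdf(4), of 0] by simp
  then have "\<forall>\<^sub>F x in at_top. x > 0 \<and> F2 x > 0"
    using eventually_gt_at_top[of 0] by eventually_elim simp
  then obtain x where "x > 0 \<and> F2 x > 0"
    by (auto simp: eventually_at_top_linorder)
  then have "{x. x > 0 \<and> F2 x > 0} \<noteq> {}" by blast
  then show ?thesis
    unfolding left_endpoint_def by (rule cInf_greatest) auto
qed

lemma F2_neg: "x < 0 \<Longrightarrow> F2 x = 0"
  using law left_endpoint_nonneg by (auto simp: regularly_varying_law_def)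

lemma g_eq:
  assumes "x \<ge> left_endpoint F2" "x > 0"
  shows "g x = x powr (- \<alpha>) * L x"
  using law assms by (auto simp: regularly_varying_law_def g_def)

lemma g_eq_eventually: "\<forall>\<^sub>F x in at_top. g x = x powr (- \<alpha>) * L x"
  using eventually_gt_at_top[of 0] eventually_ge_at_top[of "left_endpoint F2"]
  by eventually_elim (auto simp: g_eq)

lemma slowly_varying_L: "slowly_varying L"
  using law by (simp add: regularly_varying_law_def)

text \<open>A zero of \<open>L\<close> at \<open>x\<close> makes the quotient
  \<open>L (2 * x) / L x\<close> equal to \<open>0\<close> by the convention for division, which its
  limit \<open>1\<close> rules out for large \<open>x\<close>.\<close>

lemma L_nonzero: "\<forall>\<^sub>F x in at_top. L x \<noteq> 0"
proof -
  have "((\<lambda>x. L (2 * x) / L x) \<longlongrightarrow> 1) at_top"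
    using slowly_varying_L by (simp add: slowly_varying_def)
  from order_tendstoD(1)[OF this, of 0] have "\<forall>\<^sub>F x in at_top. L (2 * x) / L x > 0" by simp
  then show ?thesis by eventually_elim auto
qed

lemma g_tendsto_0: "(g \<longlongrightarrow> 0) at_top"
  using tendsto_diff[OF tendsto_const F2_cdf(4), of 1] by (simp add: g_def[abs_def])

lemma antimono_g: "antimono g"
  using F2_cdf(1) by (auto simp: g_def antimono_def mono_def)

sublocale tail: regularly_varying_tail g \<alpha>
proof
  show "antimono g" by (rule antimono_g)
  show "g x \<le> 1" for x using F2_cdf(2) by (simp add: g_def)
  show "g x > 0" for x
  proof -
    \<comment> \<open>The tail is nonzero at arbitrarily large arguments, and antitonicity carries
      positivity back to every \<open>x\<close>.\<close>
    have "\<forall>\<^sub>F y in at_top. y > 0 \<and> x \<le> y \<and> g y \<noteq> 0"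
      using eventually_gt_at_top[of 0] eventually_ge_at_top[of x] g_eq_eventually L_nonzero
      by eventually_elim auto
    then obtain y where y: "x \<le> y" "g y \<noteq> 0" by (auto simp: eventually_at_top_linorder)
    have "g y \<ge> 0" using F2_cdf(3) by (simp add: g_def)
    then show ?thesis using y antimonoD[OF antimono_g y(1)] by simp
  qed
  show "((\<lambda>x. g (t * x) / g x) \<longlongrightarrow> t powr (- \<alpha>)) at_top" if t: "t > 0" for t
  proof -
    have "((\<lambda>x. t powr (- \<alpha>) * (L (t * x) / L x)) \<longlongrightarrow> t powr (- \<alpha>) * 1) at_top"
      using slowly_varying_L t by (intro tendsto_intros) (simp add: slowly_varying_def)
    moreover have "\<forall>\<^sub>F x in at_top. t powr (- \<alpha>) * (L (t * x) / L x) = g (t * x) / g x"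
    proof -
      have "filterlim (\<lambda>x. t * x) at_top at_top"
        using t by (intro filterlim_tendsto_pos_mult_at_top[OF tendsto_const] filterlim_ident)
      then have "\<forall>\<^sub>F x in at_top. g (t * x) = (t * x) powr (- \<alpha>) * L (t * x)"
        using g_eq_eventually by (rule eventually_compose_filterlim[rotated])
      with g_eq_eventually eventually_gt_at_top[of 0] show ?thesis
        by eventually_elim (use t in \<open>auto simp: powr_mult\<close>)
    qed
    ultimately show ?thesis using tendsto_cong by fastforce
  qed
qed

lemma L_pos: "\<forall>\<^sub>F x in at_top. L x > 0"
  using g_eq_eventually eventually_gt_at_top[of 0]
proof eventually_elim
  case (elim x)
  then show ?case using tail.tail_pos[of x] by (simp add: zero_less_mult_iff)
qed

text \<open>Lets \<open>F2\<close> attain the quantile level exactly. The left endpoint itself is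
  left out because \<open>F2\<close> may jump there.\<close>

lemma isCont_F2:
  assumes "x > left_endpoint F2"
  shows "isCont F2 x"
proof -
  let ?m = "left_endpoint F2"
  have x: "x > 0" using assms left_endpoint_nonneg by simp
  have "continuous_on {x. x > 0 \<and> x \<ge> ?m} L" using law by (simp add: regularly_varying_law_def)
  then have "continuous_on {?m<..} L"
    by (rule continuous_on_subset) (use left_endpoint_nonneg in auto)
  then have "isCont L x" using assms by (simp add: continuous_on_eq_continuous_at)
  then have "isCont (\<lambda>x. 1 - x powr (- \<alpha>) * L x) x"
    using x by (intro continuous_intros) auto
  moreover have "\<forall>\<^sub>F y in nhds x. F2 y = 1 - y powr (- \<alpha>) * L y"
    using eventually_nhds_in_open[of "{?m<..}" x] assms left_endpoint_nonneg law
    by (auto elim!: eventually_mono simp: regularly_varying_law_def)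
  ultimately show ?thesis using isCont_cong by fast
qed

lemma mixture_bounds:
  "0 \<le> mixture_cdf (\<epsilon> n) (weibull_cdf lam \<tau>) F2 u" "mixture_cdf (\<epsilon> n) (weibull_cdf lam \<tau>) F2 u \<le> 1"
proof -
  have W: "0 \<le> weibull_cdf lam \<tau> u" "weibull_cdf lam \<tau> u \<le> 1"
    using lam_pos by (auto simp: weibull_cdf_def)
  then show "0 \<le> mixture_cdf (\<epsilon> n) (weibull_cdf lam \<tau>) F2 u"
    using eps[of n] F2_cdf(2)[of u] by (auto simp: mixture_cdf_def)
  have "(1 - \<epsilon> n) * weibull_cdf lam \<tau> u + \<epsilon> n * F2 u \<le> (1 - \<epsilon> n) * 1 + \<epsilon> n * 1"
    using W F2_cdf(3)[of u] eps[of n] by (intro add_mono mult_left_mono) auto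
  then show "mixture_cdf (\<epsilon> n) (weibull_cdf lam \<tau>) F2 u \<le> 1" by (simp add: mixture_cdf_def)
qed

lemma mono_P: "mono (P n)"
proof (rule monoI)
  fix x y :: real assume "x \<le> y"
  have "weibull_cdf lam \<tau> x \<le> weibull_cdf lam \<tau> y"
    using \<open>x \<le> y\<close> lam_pos tau_pos by (auto simp: weibull_cdf_def intro!: powr_mono2)
  moreover have "F2 x \<le> F2 y" using F2_cdf(1) \<open>x \<le> y\<close> by (rule monoD)
  ultimately show "P n x \<le> P n y"
    unfolding P_def using eps[of n] mixture_bounds(1)[of n x]
    by (intro power_mono) (auto simp: mixture_cdf_def intro!: add_mono mult_left_mono)
qed

text \<open>The left side is the expected number of entries of row \<open>n\<close> above
  \<open>u\<close>; it splits exactly into a Weibull and a heavy contribution. The sign condition on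
  \<open>u\<close> selects the nontrivial branch of the Weibull law.\<close>

lemma tail_mixture:
  assumes "0 \<le> u" "real (k n) > 0"
  shows "real (k n) * (1 - mixture_cdf (\<epsilon> n) (weibull_cdf lam \<tau>) F2 u) =
      (1 - \<epsilon> n) * exp (T n - lam * u powr \<tau>) + rate n * g u"
  using assms by (simp add: mixture_cdf_def weibull_cdf_def g_def exp_diff exp_minus field_simps)

lemma P_tendsto:
  assumes u: "\<forall>\<^sub>F n in sequentially. 0 \<le> u n"
    and v: "(\<lambda>n. exp (T n - lam * u n powr \<tau>)) \<longlonglongrightarrow> v"
    and b: "(\<lambda>n. rate n * g (u n)) \<longlonglongrightarrow> b"
  shows "(\<lambda>n. P n (u n)) \<longlonglongrightarrow> exp (- (v + b))"
proof -
  let ?p = "\<lambda>n. 1 - mixture_cdf (\<epsilon> n) (weibull_cdf lam \<tau>) F2 (u n)"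
  have "(\<lambda>n. (1 - \<epsilon> n) * exp (T n - lam * u n powr \<tau>) + rate n * g (u n)) \<longlonglongrightarrow> (1 - 0) * v + b"
    by (intro tendsto_intros eps_lim v b)
  moreover have "\<forall>\<^sub>F n in sequentially. (1 - \<epsilon> n) * exp (T n - lam * u n powr \<tau>) + rate n * g (u n) =
      real (k n) * ?p n"
    using u k_pos by eventually_elim (simp add: tail_mixture)
  ultimately have "(\<lambda>n. real (k n) * ?p n) \<longlonglongrightarrow> v + b"
    using tendsto_cong by fastforce
  from tendsto_power_one_minus[OF k_at_top _ this] show ?thesis
    using mixture_bounds by (simp add: P_def)
qed

lemma P_tendsto_0:
  assumes u: "\<forall>\<^sub>F n in sequentially. 0 \<le> u n"
    and v: "filterlim (\<lambda>n. T n - lam * u n powr \<tau>) at_top sequentially"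
  shows "(\<lambda>n. P n (u n)) \<longlonglongrightarrow> 0"
proof -
  let ?p = "\<lambda>n. 1 - mixture_cdf (\<epsilon> n) (weibull_cdf lam \<tau>) F2 (u n)"
  have "(\<lambda>n. 1 - \<epsilon> n) \<longlonglongrightarrow> 1" using tendsto_diff[OF tendsto_const eps_lim, of 1] by simp
  then have "filterlim (\<lambda>n. (1 - \<epsilon> n) * exp (T n - lam * u n powr \<tau>)) at_top sequentially"
    by (rule filterlim_tendsto_pos_mult_at_top) (auto intro: filterlim_compose[OF exp_at_top v])
  moreover have "\<forall>\<^sub>F n in sequentially. (1 - \<epsilon> n) * exp (T n - lam * u n powr \<tau>) \<le> real (k n) * ?p n"
    using u k_pos
  proof eventually_elim
    case (elim n)
    then show ?case using eps[of n] tail.tail_pos[of "u n"] by (simp add: tail_mixture)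
  qed
  ultimately have "filterlim (\<lambda>n. real (k n) * ?p n) at_top sequentially"
    by (rule filterlim_at_top_mono)
  from tendsto_power_one_minus_0[OF _ this] show ?thesis
    using mixture_bounds by (simp add: P_def)
qed

text \<open>At level \<open>0\<close> no Weibull mass has been passed, so the expected number of
  exceedances is at least of order \<open>k n\<close>; monotonicity covers negative levels.\<close>

lemma P_tendsto_0_nonpos:
  assumes s: "\<forall>\<^sub>F n in sequentially. s n > 0" and "x \<le> 0"
  shows "(\<lambda>n. P n (s n * x)) \<longlonglongrightarrow> 0"
proof -
  have lim: "(\<lambda>n. P n 0) \<longlonglongrightarrow> 0"
    using T_at_top tau_pos by (intro P_tendsto_0) auto
  have le: "\<forall>\<^sub>F n in sequentially. P n (s n * x) \<le> P n 0"
    using s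
  proof eventually_elim
    case (elim n)
    show ?case using elim \<open>x \<le> 0\<close> by (intro monoD[OF mono_P]) (simp add: mult_nonneg_nonpos)
  qed
  have ge: "\<forall>\<^sub>F n in sequentially. 0 \<le> P n (s n * x)"
    by (simp add: P_def mixture_bounds)
  show ?thesis using tendsto_sandwich[OF ge le tendsto_const lim] .
qed

subsection \<open>The Gumbel regime\<close>

abbreviation gu :: "real \<Rightarrow> nat \<Rightarrow> real" where
  "gu x n \<equiv> gumbel_scale lam \<tau> k n * x + gumbel_centre lam \<tau> k n"

lemma gumbel_scale_pos: "\<forall>\<^sub>F n in sequentially. gumbel_scale lam \<tau> k n > 0"
  using T_pos
proof eventually_elim
  case (elim n)
  then show ?case
    using lam_pos tau_pos unfolding gumbel_scale_def by (intro mult_pos_pos) auto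
qed

text \<open>The quotient of scale and centre is exactly \<open>1 / (\<tau> * T n)\<close>. Factoring
  out the centre brings the Weibull exponent into the form of
  \<open>gumbel_exponent_tendsto\<close>.\<close>

lemma gu_eq:
  assumes "T n > 0"
  shows "gu x n = (T n / lam) powr (1 / \<tau>) * (1 + x / (\<tau> * T n))"
proof -
  have "(T n / lam) powr (1 / \<tau> - 1) = (T n / lam) powr (1 / \<tau>) * (lam / T n)"
    using assms lam_pos by (simp add: powr_diff)
  then show ?thesis
    using assms lam_pos tau_pos
    by (simp add: gumbel_scale_def gumbel_centre_def field_simps)
qed

lemma gu_ratio: "(\<lambda>n. gu x n / (T n / lam) powr (1 / \<tau>)) \<longlonglongrightarrow> 1"
proof -
  have "((\<lambda>t. 1 + x / (\<tau> * t)) \<longlongrightarrow> 1) at_top" using tau_pos by real_asymp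
  from filterlim_compose[OF this T_at_top] have "(\<lambda>n. 1 + x / (\<tau> * T n)) \<longlonglongrightarrow> 1" .
  moreover have "\<forall>\<^sub>F n in sequentially. 1 + x / (\<tau> * T n) = gu x n / (T n / lam) powr (1 / \<tau>)"
    using T_pos by eventually_elim (use lam_pos in \<open>simp add: gu_eq\<close>)
  ultimately show ?thesis using tendsto_cong by fast
qed

lemma T_power_at_top: "filterlim (\<lambda>n. (T n / lam) powr (1 / \<tau>)) at_top sequentially"
proof -
  have "filterlim (\<lambda>t. (t / lam) powr (1 / \<tau>)) at_top at_top"
    using tau_pos lam_pos by real_asymp
  from filterlim_compose[OF this T_at_top] show ?thesis .
qed

text \<open>The constant \<open>1 / 2\<close> is an arbitrary number below the limit
  \<open>1\<close> of the ratio. The bound yields positivity, divergence and a power estimate in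
  \<open>T n\<close> under (A1).\<close>

lemma gu_ge: "\<forall>\<^sub>F n in sequentially. gu x n \<ge> (T n / lam) powr (1 / \<tau>) / 2"
proof -
  have "\<forall>\<^sub>F n in sequentially. gu x n / (T n / lam) powr (1 / \<tau>) > 1 / 2"
    by (rule order_tendstoD(1)[OF gu_ratio]) simp
  with T_pos show ?thesis
    by eventually_elim (use lam_pos in \<open>auto simp: field_simps\<close>)
qed

lemma gu_at_top: "filterlim (gu x) at_top sequentially"
proof (rule filterlim_at_top_mono[OF _ gu_ge])
  show "filterlim (\<lambda>n. (T n / lam) powr (1 / \<tau>) / 2) at_top sequentially"
    using filterlim_tendsto_pos_mult_at_top[OF tendsto_const[of "1 / 2"] _ T_power_at_top] by simp
qed

lemma gu_exponent: "(\<lambda>n. T n - lam * gu x n powr \<tau>) \<longlonglongrightarrow> - x"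
proof -
  have "(\<lambda>n. T n - T n * (1 + x / (\<tau> * T n)) powr \<tau>) \<longlonglongrightarrow> - x"
    using filterlim_compose[OF gumbel_exponent_tendsto[OF tau_pos] T_at_top] .
  moreover have "\<forall>\<^sub>F n in sequentially.
      T n - T n * (1 + x / (\<tau> * T n)) powr \<tau> = T n - lam * gu x n powr \<tau>"
    using T_pos gu_ge[of x]
  proof eventually_elim
    case (elim n)
    have c: "(T n / lam) powr (1 / \<tau>) > 0" using elim lam_pos by simp
    have "gu x n > 0" using elim(2) c by linarith
    \<comment> \<open>Positivity of this factor allows \<open>powr\<close> to split over the
      product.\<close>
    then have "1 + x / (\<tau> * T n) > 0" using c unfolding gu_eq[OF elim(1)] zero_less_mult_iff by auto
    then have "gu x n powr \<tau> = T n / lam * (1 + x / (\<tau> * T n)) powr \<tau>"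
      unfolding gu_eq[OF elim(1)] using elim(1) lam_pos tau_pos by (simp add: powr_mult powr_powr)
    then show ?case using lam_pos by simp
  qed
  ultimately show ?thesis using tendsto_cong by fast
qed

lemma gumbel_limit:
  assumes "\<And>x. (\<lambda>n. rate n * g (gu x n)) \<longlonglongrightarrow> 0"
  shows "(\<lambda>n. P n (gu x n)) \<longlonglongrightarrow> gumbel_cdf x"
proof -
  have "(\<lambda>n. P n (gu x n)) \<longlonglongrightarrow> exp (- (exp (- x) + 0))"
  proof (rule P_tendsto[OF _ _ assms])
    show "\<forall>\<^sub>F n in sequentially. 0 \<le> gu x n"
      using filterlim_at_top[THEN iffD1, OF gu_at_top] by blast
    show "(\<lambda>n. exp (T n - lam * gu x n powr \<tau>)) \<longlonglongrightarrow> exp (- x)"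
      by (intro tendsto_exp gu_exponent)
  qed
  then show ?thesis by (simp add: gumbel_cdf_def)
qed

lemma heavy_part_vanishes_bounded:
  assumes "rate_vanishing_or_const k \<epsilon>"
  shows "(\<lambda>n. rate n * g (gu x n)) \<longlonglongrightarrow> 0"
proof -
  have "\<exists>C. rate \<longlonglongrightarrow> C"
    using assms unfolding rate_vanishing_or_const_def
  proof (elim disjE exE conjE)
    fix C assume "\<forall>n. rate n = C"
    then have "rate = (\<lambda>_. C)" by auto
    then show ?thesis using tendsto_const by metis
  qed blast
  then obtain C where "rate \<longlonglongrightarrow> C" ..
  from tendsto_mult[OF this filterlim_compose[OF g_tendsto_0 gu_at_top[of x]]] show ?thesis by simp
qed

text \<open>(A1) bounds the rate by \<open>T n powr (1 / \<beta>)\<close>, while Potter's bound at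
  an argument of order \<open>T n powr (1 / \<tau>)\<close> bounds the tail by a constant times
  \<open>T n powr ((\<delta> - \<alpha>) / \<tau>)\<close>. The strict inequality
  \<open>\<beta> > \<tau> / \<alpha>\<close> leaves room for \<open>\<delta>\<close>.\<close>

lemma heavy_part_vanishes_A1:
  assumes "rate_divergent_A1 \<tau> \<alpha> k \<epsilon>"
  shows "(\<lambda>n. rate n * g (gu x n)) \<longlonglongrightarrow> 0"
proof -
  obtain \<beta> where \<beta>: "\<beta> > \<tau> / \<alpha>" and lim: "filterlim (\<lambda>n. T n / rate n powr \<beta>) at_top sequentially"
    using assms by (auto simp: rate_divergent_A1_def condA1_def)
  have \<beta>0: "\<beta> > 0" using \<beta> tau_pos alpha_pos less_trans[of 0 "\<tau> / \<alpha>" \<beta>] by simp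
  \<comment> \<open>Half of the gap: one half pays for the loss in Potter's bound, the other leaves
    the decay \<open>T n powr (- \<delta> / \<tau>)\<close>.\<close>
  define \<delta> where "\<delta> = (\<alpha> - \<tau> / \<beta>) / 2"
  have \<delta>: "\<delta> > 0" using \<beta> \<beta>0 alpha_pos by (simp add: \<delta>_def field_simps)
  have "2 * \<delta> = \<alpha> - \<tau> / \<beta>" by (simp add: \<delta>_def)
  then have \<delta>2: "\<delta> - \<alpha> = - \<delta> - \<tau> / \<beta>" by linarith
  have "\<tau> / \<beta> > 0" using \<beta>0 tau_pos by simp
  then have \<delta>\<alpha>: "\<delta> - \<alpha> \<le> 0" using \<delta>2 \<delta> by linarith
  have ex: "1 / \<beta> + (\<delta> - \<alpha>) / \<tau> = - \<delta> / \<tau>"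
    unfolding \<delta>2 using tau_pos by (simp add: diff_divide_distrib)
  obtain C where C: "C > 0" "\<forall>\<^sub>F x in at_top. g x \<le> C * x powr (\<delta> - \<alpha>)"
    using tail.potter_upper[OF \<delta>] .
  have "\<forall>\<^sub>F n in sequentially. T n / rate n powr \<beta> \<ge> 1"
    using filterlim_at_top[THEN iffD1, OF lim] by blast
  then have rate_le: "\<forall>\<^sub>F n in sequentially. rate n \<le> T n powr (1 / \<beta>)"
  proof eventually_elim
    case (elim n)
    have "rate n powr \<beta> > 0" using rate_pos[of n] unfolding powr_gt_zero by linarith
    then have "rate n powr \<beta> \<le> T n" using elim(1) by (simp only: pos_le_divide_eq mult_1)
    then have "(rate n powr \<beta>) powr (1 / \<beta>) \<le> T n powr (1 / \<beta>)"
      using \<beta>0 by (intro powr_mono2) auto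
    then show ?case using rate_pos[of n] \<beta>0 by (simp add: powr_powr)
  qed
  \<comment> \<open>Chosen so that the lower bound in \<open>gu_ge\<close> reads
    \<open>w * T n powr (1 / \<tau>)\<close>.\<close>
  define w where "w = lam powr (- 1 / \<tau>) / 2"
  define K where "K = C * w powr (\<delta> - \<alpha>)"
  have w: "w > 0" using lam_pos by (simp add: w_def)
  have le: "\<forall>\<^sub>F n in sequentially. rate n * g (gu x n) \<le> K * T n powr (- \<delta> / \<tau>)"
    using rate_le T_pos gu_ge[of x] eventually_compose_filterlim[OF C(2) gu_at_top[of x]]
  proof eventually_elim
    case (elim n)
    have half: "(T n / lam) powr (1 / \<tau>) / 2 = w * T n powr (1 / \<tau>)"
      using elim lam_pos by (simp add: w_def powr_divide powr_minus field_simps)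
    have "g (gu x n) \<le> C * gu x n powr (\<delta> - \<alpha>)" using elim by blast
    \<comment> \<open>The exponent is nonpositive, so the lower bound on \<open>gu x n\<close> gives
      an upper bound on its power.\<close>
    also have "\<dots> \<le> C * ((T n / lam) powr (1 / \<tau>) / 2) powr (\<delta> - \<alpha>)"
      using elim \<delta>\<alpha> C(1) lam_pos by (intro mult_left_mono powr_mono2') auto
    also have "\<dots> = K * T n powr ((\<delta> - \<alpha>) / \<tau>)"
      using elim w unfolding half by (simp add: K_def powr_mult powr_powr)
    finally have "rate n * g (gu x n) \<le> T n powr (1 / \<beta>) * (K * T n powr ((\<delta> - \<alpha>) / \<tau>))"
      using elim tail.tail_pos[of "gu x n"] by (intro mult_mono) auto
    also have "\<dots> = K * (T n powr (1 / \<beta>) * T n powr ((\<delta> - \<alpha>) / \<tau>))" by simp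
    also have "T n powr (1 / \<beta>) * T n powr ((\<delta> - \<alpha>) / \<tau>) = T n powr (- \<delta> / \<tau>)"
      by (simp only: powr_add[symmetric] ex)
    finally show ?case .
  qed
  have ge: "\<forall>\<^sub>F n in sequentially. 0 \<le> rate n * g (gu x n)"
    using rate_pos tail.tail_pos by (intro always_eventually allI mult_nonneg_nonneg less_imp_le)
  have lim: "(\<lambda>n. K * T n powr (- \<delta> / \<tau>)) \<longlonglongrightarrow> 0"
  proof -
    have "((\<lambda>t. K * t powr (- \<delta> / \<tau>)) \<longlongrightarrow> 0) at_top" using \<delta> tau_pos by real_asymp
    from filterlim_compose[OF this T_at_top] show ?thesis .
  qed
  show ?thesis using tendsto_sandwich[OF ge le tendsto_const lim] .
qed

text \<open>The factor \<open>T n powr (\<alpha> / \<tau>)\<close> in the rate cancels the growth of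
  \<open>s n powr \<alpha>\<close>, leaving only the ratio \<open>r\<close> and the limit of
  \<open>L\<close>. Serves the Gumbel case with \<open>l = 0\<close> and the discontinuous case with
  \<open>l > 0\<close>.\<close>

lemma heavy_part_tendsto_A3:
  assumes A3: "condA3_with \<tau> \<alpha> k \<epsilon> d"
    and s: "filterlim s at_top sequentially"
    and ratio: "(\<lambda>n. s n / T n powr (1 / \<tau>)) \<longlonglongrightarrow> r" "r > 0"
    and L: "(L \<longlongrightarrow> l) at_top"
  shows "(\<lambda>n. rate n * g (s n)) \<longlonglongrightarrow> d * r powr (- \<alpha>) * l"
proof -
  have "(\<lambda>n. d * (s n / T n powr (1 / \<tau>)) powr (- \<alpha>) * L (s n)) \<longlonglongrightarrow> d * r powr (- \<alpha>) * l"
    using ratio by (intro tendsto_intros filterlim_compose[OF L s]) auto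
  moreover have "\<forall>\<^sub>F n in sequentially.
      d * (s n / T n powr (1 / \<tau>)) powr (- \<alpha>) * L (s n) = rate n * g (s n)"
    using T_pos eventually_compose_filterlim[OF g_eq_eventually s]
      eventually_compose_filterlim[OF eventually_gt_at_top[of 0] s]
  proof eventually_elim
    case (elim n)
    have "(s n / T n powr (1 / \<tau>)) powr (- \<alpha>) = s n powr (- \<alpha>) * T n powr (\<alpha> / \<tau>)"
      using elim by (simp add: powr_divide powr_powr powr_minus field_simps)
    moreover have "rate n = d * T n powr (\<alpha> / \<tau>)" using A3 by (simp add: condA3_with_def)
    ultimately show ?case using elim by simp
  qed
  ultimately show ?thesis using tendsto_cong by fast
qed

lemma gu_ratio_T: "(\<lambda>n. gu x n / T n powr (1 / \<tau>)) \<longlonglongrightarrow> lam powr (- 1 / \<tau>)"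
proof -
  have "(\<lambda>n. gu x n / (T n / lam) powr (1 / \<tau>) * lam powr (- 1 / \<tau>)) \<longlonglongrightarrow> 1 * lam powr (- 1 / \<tau>)"
    by (intro tendsto_intros gu_ratio)
  moreover have "\<forall>\<^sub>F n in sequentially.
      gu x n / (T n / lam) powr (1 / \<tau>) * lam powr (- 1 / \<tau>) = gu x n / T n powr (1 / \<tau>)"
    using T_pos by eventually_elim (use lam_pos in \<open>simp add: powr_divide powr_minus field_simps\<close>)
  ultimately show ?thesis using tendsto_cong by fastforce
qed

lemma gumbel_condition_limit:
  assumes "gumbel_condition \<tau> \<alpha> L k \<epsilon>"
  shows "(\<lambda>n. P n (gu x n)) \<longlonglongrightarrow> gumbel_cdf x"
proof (rule gumbel_limit)
  fix y
  consider "rate_vanishing_or_const k \<epsilon>" | "rate_divergent_A1 \<tau> \<alpha> k \<epsilon>"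
    | d where "condA3_with \<tau> \<alpha> k \<epsilon> d" "(L \<longlongrightarrow> 0) at_top"
    using assms by (auto simp: gumbel_condition_def condA3_def)
  then show "(\<lambda>n. rate n * g (gu y n)) \<longlonglongrightarrow> 0"
  proof cases
    case 3
    from heavy_part_tendsto_A3[OF 3(1) gu_at_top gu_ratio_T _ 3(2)] show ?thesis
      using lam_pos by simp
  qed (fact heavy_part_vanishes_bounded heavy_part_vanishes_A1)+
qed

subsection \<open>The Frechet and the discontinuous regime\<close>

lemma quantile_F2_ge:
  assumes "F2 B < y" "y < 1"
  shows "quantile F2 y \<ge> B"
proof -
  have "\<forall>\<^sub>F x in at_top. F2 x > y" using order_tendstoD(1)[OF F2_cdf(4) assms(2)] .
  then obtain x where "F2 x > y" by (auto simp: eventually_at_top_linorder)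
  then have "{x. F2 x \<ge> y} \<noteq> {}" using less_imp_le by blast
  then show ?thesis
    unfolding quantile_def
  proof (rule cInf_greatest)
    fix x assume "x \<in> {x. F2 x \<ge> y}"
    then show "B \<le> x" using assms monoD[OF F2_cdf(1), of x B] by (cases "B \<le> x") auto
  qed
qed

text \<open>Monotonicity only gives \<open>F2 x \<le> y\<close> left of the quantile and
  \<open>y \<le> F2 x\<close> right of it; continuity there closes the gap.\<close>

lemma F2_quantile:
  assumes "0 < y" "y < 1" "quantile F2 y > left_endpoint F2"
  shows "F2 (quantile F2 y) = y"
proof (rule antisym)
  let ?q = "quantile F2 y"
  \<comment> \<open>A positive level is never reached at negative arguments, which bounds the set
    under the infimum from below.\<close>
  have nonneg: "0 \<le> x" if "y \<le> F2 x" for x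
    using that assms F2_neg[of x] by (cases "0 \<le> x") auto
  have bdd: "bdd_below {x. F2 x \<ge> y}"
    by (rule bdd_belowI[of _ 0]) (simp add: nonneg)
  have "\<forall>\<^sub>F x in at_top. F2 x > y" using order_tendstoD(1)[OF F2_cdf(4) assms(2)] .
  then obtain x where "F2 x > y" by (auto simp: eventually_at_top_linorder)
  then have ne: "{x. F2 x \<ge> y} \<noteq> {}" using less_imp_le by blast
  have above: "y \<le> F2 x" if "x > ?q" for x
  proof -
    have "Inf {x. F2 x \<ge> y} < x" using that by (simp add: quantile_def)
    then obtain z where "z \<in> {x. F2 x \<ge> y}" "z < x" using cInf_lessD[OF ne] by blast
    then show ?thesis using monoD[OF F2_cdf(1), of z x] by simp
  qed
  have below: "F2 x \<le> y" if "x < ?q" for x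
    using that cInf_lower[OF _ bdd, of x] unfolding quantile_def by (cases "F2 x \<le> y") auto
  have lim: "(F2 \<longlongrightarrow> F2 ?q) (at ?q)" using isCont_F2[OF assms(3)] by (simp add: isCont_def)
  show "F2 ?q \<le> y"
    by (rule tendsto_upperbound[OF tendsto_mono[OF at_le[OF subset_UNIV] lim, of "{..<?q}"]])
      (auto simp: eventually_at_filter intro!: always_eventually below)
  show "y \<le> F2 ?q"
    by (rule tendsto_lowerbound[OF tendsto_mono[OF at_le[OF subset_UNIV] lim, of "{?q<..}"]])
      (auto simp: eventually_at_filter intro!: always_eventually above)
qed

text \<open>Puts the level \<open>1 - inverse (rate n)\<close> eventually strictly between
  \<open>0\<close> and \<open>1\<close>, where \<open>quantile\<close> is meaningful.\<close>

lemma inverse_rate: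
  assumes "filterlim rate at_top sequentially"
  shows "(\<lambda>n. inverse (rate n)) \<longlonglongrightarrow> 0"
    and "\<forall>\<^sub>F n in sequentially. 0 < inverse (rate n) \<and> inverse (rate n) < 1"
proof -
  show "(\<lambda>n. inverse (rate n)) \<longlonglongrightarrow> 0"
    using assms by (rule tendsto_inverse_0_at_top)
  have "\<forall>\<^sub>F n in sequentially. rate n > 1"
    using filterlim_at_top_dense[THEN iffD1, OF assms] by blast
  then show "\<forall>\<^sub>F n in sequentially. 0 < inverse (rate n) \<and> inverse (rate n) < 1"
  proof eventually_elim
    case (elim n)
    then show ?case using rate_pos[of n] one_less_inverse_iff[of "inverse (rate n)"]
      by (simp only: inverse_inverse_eq positive_imp_inverse_positive)
  qed
qed

text \<open>The tail \<open>g\<close> is positive at every \<open>B\<close>, so the vanishing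
  numbers \<open>inverse (rate n)\<close> eventually drop below \<open>g B\<close>.\<close>

lemma frechet_scale_at_top:
  assumes "filterlim rate at_top sequentially"
  shows "filterlim (frechet_scale F2 k \<epsilon>) at_top sequentially"
  unfolding filterlim_at_top
proof
  fix B
  have "\<forall>\<^sub>F n in sequentially. inverse (rate n) < g B"
    using order_tendstoD(2)[OF inverse_rate(1)[OF assms] tail.tail_pos] .
  with inverse_rate(2)[OF assms] show "\<forall>\<^sub>F n in sequentially. B \<le> frechet_scale F2 k \<epsilon> n"
  proof eventually_elim
    case (elim n)
    then show ?case unfolding frechet_scale_def g_def by (intro quantile_F2_ge) linarith+
  qed
qed

text \<open>The reason for the quantile scale: at this level the expected number of heavy
  exceedances is exactly \<open>1\<close>. Exactness is obtained once the quantile lies beyond the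
  left endpoint, hence for large \<open>n\<close>.\<close>

lemma rate_tail_frechet_scale:
  assumes "filterlim rate at_top sequentially"
  shows "\<forall>\<^sub>F n in sequentially. rate n * g (frechet_scale F2 k \<epsilon> n) = 1"
proof -
  have "\<forall>\<^sub>F n in sequentially. frechet_scale F2 k \<epsilon> n > left_endpoint F2"
    using filterlim_at_top_dense[THEN iffD1, OF frechet_scale_at_top[OF assms]] by blast
  with inverse_rate(2)[OF assms] show ?thesis
  proof eventually_elim
    case (elim n)
    then have "g (frechet_scale F2 k \<epsilon> n) = inverse (rate n)"
      unfolding g_def frechet_scale_def by (subst F2_quantile) auto
    then show ?case using rate_pos[of n] by (simp only: right_inverse)
  qed
qed

lemma heavy_part_tendsto_frechet_scale:
  assumes "filterlim rate at_top sequentially" and "x > 0"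
  shows "(\<lambda>n. rate n * g (frechet_scale F2 k \<epsilon> n * x)) \<longlonglongrightarrow> x powr (- \<alpha>)"
proof -
  have "(\<lambda>n. g (x * frechet_scale F2 k \<epsilon> n) / g (frechet_scale F2 k \<epsilon> n)) \<longlonglongrightarrow> x powr (- \<alpha>)"
    using filterlim_compose[OF tail.tail_ratio[OF assms(2)] frechet_scale_at_top[OF assms(1)]] .
  moreover have "\<forall>\<^sub>F n in sequentially. g (x * frechet_scale F2 k \<epsilon> n) / g (frechet_scale F2 k \<epsilon> n) =
      rate n * g (frechet_scale F2 k \<epsilon> n * x)"
    using rate_tail_frechet_scale[OF assms(1)]
  proof eventually_elim
    case (elim n)
    have "g (frechet_scale F2 k \<epsilon> n) \<noteq> 0" using tail.tail_pos[of "frechet_scale F2 k \<epsilon> n"] by linarith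
    then have "rate n = 1 / g (frechet_scale F2 k \<epsilon> n)" using elim by (simp only: eq_divide_eq) simp
    then show ?case by (simp only: mult.commute[of x] times_divide_eq_left mult_1)
  qed
  ultimately show ?thesis using tendsto_cong by fast
qed

section \<open>Limits along a general scale\<close>

lemma eventually_pos_if_at_top:
  "filterlim s at_top sequentially \<Longrightarrow> \<forall>\<^sub>F n in sequentially. (s n :: real) > 0"
  using filterlim_at_top_dense by blast

text \<open>Whether the Weibull part explodes or vanishes is decided by the limit of \<open>s n powr \<tau> / T n\<close>.\<close>

lemma light_exponent_eq:
  assumes "T n > 0" "s n > 0" "x > 0"
  shows "T n - lam * (s n * x) powr \<tau> = T n * (1 - lam * x powr \<tau> * (s n powr \<tau> / T n))"
  using assms by (simp add: powr_mult field_simps)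

lemma frechet_limit:
  assumes s: "filterlim s at_top sequentially"
    and heavy: "\<And>x. x > 0 \<Longrightarrow> (\<lambda>n. rate n * g (s n * x)) \<longlonglongrightarrow> x powr (- \<alpha>)"
    and light: "filterlim (\<lambda>n. s n powr \<tau> / T n) at_top sequentially"
  shows "(\<lambda>n. P n (s n * x)) \<longlonglongrightarrow> frechet_cdf \<alpha> x"
proof (cases "x > 0")
  case True
  have spos: "\<forall>\<^sub>F n in sequentially. s n > 0" by (rule eventually_pos_if_at_top[OF s])
  have "filterlim (\<lambda>n. lam * x powr \<tau> * (s n powr \<tau> / T n)) at_top sequentially"
    using lam_pos True by (intro filterlim_tendsto_pos_mult_at_top[OF tendsto_const _ light]) auto
  from filterlim_tendsto_add_at_top[OF tendsto_const[of "- 1"] this]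
  have "filterlim (\<lambda>n. - 1 + lam * x powr \<tau> * (s n powr \<tau> / T n)) at_top sequentially" .
  then have "filterlim (\<lambda>n. T n * (- 1 + lam * x powr \<tau> * (s n powr \<tau> / T n))) at_top sequentially"
    by (rule filterlim_at_top_mult_at_top[OF T_at_top])
  then have "filterlim (\<lambda>n. - (T n * (1 - lam * x powr \<tau> * (s n powr \<tau> / T n)))) at_top sequentially"
    by (simp add: algebra_simps)
  then have "filterlim (\<lambda>n. T n * (1 - lam * x powr \<tau> * (s n powr \<tau> / T n))) at_bot sequentially"
    by (simp add: filterlim_uminus_at_bot)
  moreover have "\<forall>\<^sub>F n in sequentially. T n * (1 - lam * x powr \<tau> * (s n powr \<tau> / T n)) =
      T n - lam * (s n * x) powr \<tau>"
    using T_pos spos by eventually_elim (simp only: light_exponent_eq[OF _ _ True])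
  ultimately have "filterlim (\<lambda>n. T n - lam * (s n * x) powr \<tau>) at_bot sequentially"
    using filterlim_cong[OF refl refl] by fast
  then have "(\<lambda>n. exp (T n - lam * (s n * x) powr \<tau>)) \<longlonglongrightarrow> 0"
    by (rule filterlim_compose[OF exp_at_bot])
  moreover have "\<forall>\<^sub>F n in sequentially. 0 \<le> s n * x"
    using spos by eventually_elim (use True in simp)
  ultimately have "(\<lambda>n. P n (s n * x)) \<longlonglongrightarrow> exp (- (0 + x powr (- \<alpha>)))"
    using heavy[OF True] by (intro P_tendsto)
  then show ?thesis using True by (simp add: frechet_cdf_def)
next
  case False
  then show ?thesis
    using P_tendsto_0_nonpos[OF eventually_pos_if_at_top[OF s], of x] by (simp add: frechet_cdf_def)
qed

text \<open>Identifies the jump point as the zero of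
  \<open>1 - lam * x powr \<tau> * (d * l) powr (\<tau> / \<alpha>)\<close>, the limiting
  coefficient of \<open>T n\<close> in the Weibull exponent.\<close>

lemma jump_point_powr:
  assumes "d > 0" "l > 0"
  shows "lam * jump_point lam \<tau> \<alpha> d l powr \<tau> * (d * l) powr (\<tau> / \<alpha>) = 1"
proof -
  have "jump_point lam \<tau> \<alpha> d l powr \<tau> = lam powr (- 1) * (d * l) powr (- (\<tau> / \<alpha>))"
    using tau_pos lam_pos assms by (simp add: jump_point_def powr_mult powr_powr del: powr_minus)
  moreover have "(d * l) powr (- (\<tau> / \<alpha>)) * (d * l) powr (\<tau> / \<alpha>) = 1"
    using assms by (simp only: powr_add[symmetric]) simp
  moreover have "lam * lam powr (- 1) = 1" using lam_pos by (simp add: powr_minus powr_one)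
  ultimately show ?thesis by (metis mult.assoc mult_1)
qed

text \<open>The hypothesis \<open>at_jump\<close> resolves the product of \<open>T n\<close> with a
  vanishing coefficient. It is guarded by \<open>x = jump_point lam \<tau> \<alpha> d l\<close>, so
  that convergence off the jump carries no condition on speed.\<close>

lemma discontinuous_limit:
  assumes s: "filterlim s at_top sequentially"
    and heavy: "\<And>x. x > 0 \<Longrightarrow> (\<lambda>n. rate n * g (s n * x)) \<longlonglongrightarrow> x powr (- \<alpha>)"
    and light: "(\<lambda>n. s n powr \<tau> / T n) \<longlonglongrightarrow> (d * l) powr (\<tau> / \<alpha>)"
    and d: "d > 0" and l: "l > 0"
    and at_jump: "x = jump_point lam \<tau> \<alpha> d l \<Longrightarrow>
      (\<lambda>n. T n * (1 - s n powr \<tau> / T n / (d * l) powr (\<tau> / \<alpha>))) \<longlonglongrightarrow> 0"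
  shows "(\<lambda>n. P n (s n * x)) \<longlonglongrightarrow> discontinuous_law lam \<tau> \<alpha> d l x"
proof -
  let ?j = "jump_point lam \<tau> \<alpha> d l" and ?\<rho> = "(d * l) powr (\<tau> / \<alpha>)"
  let ?e = "\<lambda>n. 1 - lam * x powr \<tau> * (s n powr \<tau> / T n)"
  note jump = jump_point_powr[OF d l]
  have spos: "\<forall>\<^sub>F n in sequentially. s n > 0" by (rule eventually_pos_if_at_top[OF s])
  have j: "?j > 0" by (rule jump_point_pos[OF lam_pos alpha_pos d l])
  have \<rho>: "?\<rho> > 0" using d l by simp
  have e: "?e \<longlonglongrightarrow> 1 - lam * x powr \<tau> * ?\<rho>" by (intro tendsto_intros light)
  have ex: "\<forall>\<^sub>F n in sequentially. T n * ?e n = T n - lam * (s n * x) powr \<tau>" if "x > 0"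
    using T_pos spos by eventually_elim (simp only: light_exponent_eq[OF _ _ that])
  have nonneg: "\<forall>\<^sub>F n in sequentially. 0 \<le> s n * x" if "x > 0"
    using spos by eventually_elim (use that in simp)
  consider "x \<le> 0" | "0 < x" "x < ?j" | "x = ?j" | "x > ?j" by linarith
  then show ?thesis
  proof cases
    case 1
    then show ?thesis using P_tendsto_0_nonpos[OF spos, of x] j by (simp add: discontinuous_law_def)
  next
    case 2
    have "x powr \<tau> < ?j powr \<tau>" using 2 tau_pos by (intro powr_less_mono2) auto
    then have "lam * x powr \<tau> * ?\<rho> < 1"
      unfolding jump[symmetric] using lam_pos \<rho> by (intro mult_strict_right_mono mult_strict_left_mono)
    then have "filterlim (\<lambda>n. ?e n * T n) at_top sequentially"
      by (intro filterlim_tendsto_pos_mult_at_top[OF e _ T_at_top]) simp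
    then have "filterlim (\<lambda>n. T n - lam * (s n * x) powr \<tau>) at_top sequentially"
      using filterlim_cong[OF refl refl ex[OF 2(1)]] by (simp only: mult.commute)
    then have "(\<lambda>n. P n (s n * x)) \<longlonglongrightarrow> 0" by (rule P_tendsto_0[OF nonneg[OF 2(1)]])
    then show ?thesis using 2 by (simp add: discontinuous_law_def)
  next
    case 3
    have x: "x > 0" using 3 j by simp
    have "lam * x powr \<tau> = 1 / ?\<rho>" using jump \<rho> 3 by (simp add: field_simps)
    then have "?e n = 1 - s n powr \<tau> / T n / ?\<rho>" for n by simp
    then have "(\<lambda>n. T n * ?e n) \<longlonglongrightarrow> 0" using at_jump[OF 3] by simp
    then have "(\<lambda>n. T n - lam * (s n * x) powr \<tau>) \<longlonglongrightarrow> 0"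
      using tendsto_cong[OF ex[OF x]] by simp
    then have "(\<lambda>n. exp (T n - lam * (s n * x) powr \<tau>)) \<longlonglongrightarrow> exp 0" by (rule tendsto_exp)
    from P_tendsto[OF nonneg[OF x] this heavy[OF x]] show ?thesis
      using 3 by (simp add: discontinuous_law_def)
  next
    case 4
    have x: "x > 0" using 4 j by simp
    have "?j powr \<tau> < x powr \<tau>" using 4 tau_pos j by (intro powr_less_mono2) auto
    then have "1 < lam * x powr \<tau> * ?\<rho>"
      unfolding jump[symmetric] using lam_pos \<rho> by (intro mult_strict_right_mono mult_strict_left_mono)
    then have "filterlim (\<lambda>n. ?e n * T n) at_bot sequentially"
      by (intro filterlim_tendsto_neg_mult_at_bot[OF e _ T_at_top]) simp
    then have "filterlim (\<lambda>n. T n - lam * (s n * x) powr \<tau>) at_bot sequentially"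
      using filterlim_cong[OF refl refl ex[OF x]] by (simp only: mult.commute)
    then have "(\<lambda>n. exp (T n - lam * (s n * x) powr \<tau>)) \<longlonglongrightarrow> 0"
      by (rule filterlim_compose[OF exp_at_bot])
    from P_tendsto[OF nonneg[OF x] this heavy[OF x]] show ?thesis
      using 4 by (simp add: discontinuous_law_def)
  qed
qed

section \<open>Growth of the rate and of the quantile scale\<close>

lemma rate_at_top_A3:
  assumes "condA3_with \<tau> \<alpha> k \<epsilon> d"
  shows "filterlim rate at_top sequentially"
proof -
  have d: "d > 0" and eq: "rate = (\<lambda>n. d * T n powr (\<alpha> / \<tau>))"
    using assms by (auto simp: condA3_with_def)
  have "filterlim (\<lambda>t. d * t powr (\<alpha> / \<tau>)) at_top at_top"
    using d alpha_pos tau_pos by real_asymp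
  from filterlim_compose[OF this T_at_top] show ?thesis unfolding eq .
qed

text \<open>(A2) does not mention divergence of the rate. It follows because
  \<open>rate n powr \<beta>\<close> dominates \<open>T n\<close>, which itself diverges.\<close>

lemma rate_at_top_A2:
  assumes "0 < \<beta>" and "(\<lambda>n. T n / rate n powr \<beta>) \<longlonglongrightarrow> 0"
  shows "filterlim rate at_top sequentially"
    and "filterlim (\<lambda>n. rate n powr \<beta> / T n) at_top sequentially"
proof -
  have "\<forall>\<^sub>F n in sequentially. T n / rate n powr \<beta> > 0"
    using T_pos
  proof eventually_elim
    case (elim n)
    have "rate n powr \<beta> > 0" using rate_pos[of n] unfolding powr_gt_zero by linarith
    with elim show ?case by (rule divide_pos_pos)
  qed
  then have "filterlim (\<lambda>n. inverse (T n / rate n powr \<beta>)) at_top sequentially"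
    using assms(2) by (intro filterlim_inverse_at_top)
  then show *: "filterlim (\<lambda>n. rate n powr \<beta> / T n) at_top sequentially"
    by (simp only: inverse_divide)
  have "filterlim (\<lambda>n. rate n powr \<beta> / T n * T n) at_top sequentially"
    by (rule filterlim_at_top_mult_at_top[OF * T_at_top])
  moreover have "\<forall>\<^sub>F n in sequentially. rate n powr \<beta> / T n * T n = rate n powr \<beta>"
    using T_pos by eventually_elim simp
  ultimately have "filterlim (\<lambda>n. rate n powr \<beta>) at_top sequentially"
    using filterlim_cong[OF refl refl] by fast
  moreover have "filterlim (\<lambda>t::real. t powr (1 / \<beta>)) at_top at_top"
    using assms(1) by real_asymp
  ultimately have "filterlim (\<lambda>n. (rate n powr \<beta>) powr (1 / \<beta>)) at_top sequentially"
    using filterlim_compose by blast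
  moreover have "(rate n powr \<beta>) powr (1 / \<beta>) = rate n" for n
    using assms(1) rate_pos[of n] by (simp add: powr_powr)
  ultimately show "filterlim rate at_top sequentially" by (simp only:)
qed

text \<open>A lower bound on the tail is a lower bound on its quantiles: Potter's inequality,
  inserted into the equation that fixes the scale, gives
  \<open>C * rate n \<le> s n powr (\<tau> / \<beta>)\<close>, and (A2) makes
  \<open>rate n powr \<beta>\<close> outgrow \<open>T n\<close>.\<close>

lemma frechet_scale_light_A2:
  assumes \<beta>: "0 < \<beta>" "\<beta> < \<tau> / \<alpha>" and lim: "(\<lambda>n. T n / rate n powr \<beta>) \<longlonglongrightarrow> 0"
  shows "filterlim (\<lambda>n. frechet_scale F2 k \<epsilon> n powr \<tau> / T n) at_top sequentially"
proof -
  let ?s = "frechet_scale F2 k \<epsilon>"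
  note rate = rate_at_top_A2[OF \<beta>(1) lim]
  \<comment> \<open>Makes the Potter exponent \<open>\<alpha> + \<delta>\<close> equal to
    \<open>\<tau> / \<beta>\<close>, so that raising to the power \<open>\<beta>\<close> produces
    \<open>?s n powr \<tau>\<close>.\<close>
  define \<delta> where "\<delta> = \<tau> / \<beta> - \<alpha>"
  have \<delta>: "\<delta> > 0" using \<beta> alpha_pos by (simp add: \<delta>_def field_simps)
  have sum: "\<alpha> + \<delta> = \<tau> / \<beta>" by (simp add: \<delta>_def)
  obtain C where C: "C > 0" "\<forall>\<^sub>F x in at_top. C * x powr (- (\<alpha> + \<delta>)) \<le> g x"
    using tail.potter_lower[OF \<delta> alpha_pos] .
  note s = frechet_scale_at_top[OF rate(1)]
  have "\<forall>\<^sub>F n in sequentially. C powr \<beta> * (rate n powr \<beta> / T n) \<le> ?s n powr \<tau> / T n"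
    using rate_tail_frechet_scale[OF rate(1)] eventually_compose_filterlim[OF C(2) s]
      eventually_pos_if_at_top[OF s] T_pos
  proof eventually_elim
    case (elim n)
    have "rate n * (C * ?s n powr (- (\<alpha> + \<delta>))) \<le> rate n * g (?s n)"
      using elim(2) rate_pos[of n] by (intro mult_left_mono) linarith+
    then have "rate n * (C * ?s n powr (- (\<alpha> + \<delta>))) \<le> 1" using elim(1) by simp
    then have "rate n * (C * ?s n powr (- (\<alpha> + \<delta>))) * ?s n powr (\<alpha> + \<delta>) \<le> 1 * ?s n powr (\<alpha> + \<delta>)"
      by (rule mult_right_mono) simp
    moreover have "?s n powr (- (\<alpha> + \<delta>)) * ?s n powr (\<alpha> + \<delta>) = 1"
      using elim(3) by (simp only: powr_add[symmetric]) simp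
    moreover have "rate n * (C * a) * b = C * rate n * (a * b)" for a b by simp
    ultimately have "C * rate n \<le> ?s n powr (\<tau> / \<beta>)"
      unfolding sum by (simp only: mult_1 mult_1_right)
    then have "(C * rate n) powr \<beta> \<le> (?s n powr (\<tau> / \<beta>)) powr \<beta>"
      using \<beta> C(1) rate_pos[of n] by (intro powr_mono2) (auto intro: mult_nonneg_nonneg less_imp_le)
    then have "C powr \<beta> * rate n powr \<beta> \<le> ?s n powr \<tau>"
      using \<beta> C(1) rate_pos[of n] by (simp add: powr_mult powr_powr)
    then show ?case using elim(4) by (simp only: times_divide_eq_right divide_right_mono less_imp_le)
  qed
  moreover have "filterlim (\<lambda>n. C powr \<beta> * (rate n powr \<beta> / T n)) at_top sequentially"
    using C(1) by (intro filterlim_tendsto_pos_mult_at_top[OF tendsto_const _ rate(2)]) simp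
  ultimately show ?thesis by (rule filterlim_at_top_mono[rotated])
qed

text \<open>Obtained by solving \<open>rate n * g (s n) = 1\<close> for
  \<open>s n powr \<tau>\<close>. The limit of \<open>L\<close> thereby decides whether the Weibull
  part disappears or lives on the same scale.\<close>

lemma frechet_scale_light_A3:
  assumes A3: "condA3_with \<tau> \<alpha> k \<epsilon> d"
  shows "\<forall>\<^sub>F n in sequentially. frechet_scale F2 k \<epsilon> n powr \<tau> / T n =
    (d * L (frechet_scale F2 k \<epsilon> n)) powr (\<tau> / \<alpha>)"
proof -
  let ?s = "frechet_scale F2 k \<epsilon>"
  note rate = rate_at_top_A3[OF A3]
  note s = frechet_scale_at_top[OF rate]
  have d: "d > 0" using A3 by (simp add: condA3_with_def)
  show ?thesis
    using rate_tail_frechet_scale[OF rate] eventually_compose_filterlim[OF g_eq_eventually s]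
      eventually_compose_filterlim[OF L_pos s] eventually_pos_if_at_top[OF s] T_pos
  proof eventually_elim
    case (elim n)
    have "rate n = d * T n powr (\<alpha> / \<tau>)" using A3 by (simp add: condA3_with_def)
    then have "d * T n powr (\<alpha> / \<tau>) * (?s n powr (- \<alpha>) * L (?s n)) = 1"
      using elim(1,2) by (simp only: mult.commute)
    then have "d * T n powr (\<alpha> / \<tau>) * (?s n powr (- \<alpha>) * L (?s n)) * ?s n powr \<alpha> = ?s n powr \<alpha>"
      by simp
    moreover have "?s n powr (- \<alpha>) * ?s n powr \<alpha> = 1"
      using elim(4) by (simp only: powr_add[symmetric]) simp
    then have "d * T n powr (\<alpha> / \<tau>) * (?s n powr (- \<alpha>) * L (?s n)) * ?s n powr \<alpha> =
        (d * L (?s n)) * T n powr (\<alpha> / \<tau>)" by algebra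
    ultimately have "(?s n powr \<alpha>) powr (\<tau> / \<alpha>) = ((d * L (?s n)) * T n powr (\<alpha> / \<tau>)) powr (\<tau> / \<alpha>)"
      by simp
    then have "?s n powr \<tau> = (d * L (?s n)) powr (\<tau> / \<alpha>) * T n"
      using elim d alpha_pos tau_pos by (simp add: powr_mult powr_powr)
    then show ?case using elim(5) by simp
  qed
qed

lemma frechet_condition_rate:
  assumes "frechet_condition \<tau> \<alpha> L k \<epsilon>"
  shows "filterlim rate at_top sequentially"
    and "filterlim (\<lambda>n. frechet_scale F2 k \<epsilon> n powr \<tau> / T n) at_top sequentially"
proof -
  let ?s = "frechet_scale F2 k \<epsilon>"
  consider \<beta> where "0 < \<beta>" "\<beta> < \<tau> / \<alpha>" "(\<lambda>n. T n / rate n powr \<beta>) \<longlonglongrightarrow> 0"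
    | d where "condA3_with \<tau> \<alpha> k \<epsilon> d" "filterlim L at_top at_top"
    using assms by (auto simp: frechet_condition_def condA2_def condA3_def)
  then have "filterlim rate at_top sequentially \<and> filterlim (\<lambda>n. ?s n powr \<tau> / T n) at_top sequentially"
  proof cases
    case 1
    then show ?thesis using rate_at_top_A2 frechet_scale_light_A2 by blast
  next
    case 2
    have d: "d > 0" using 2 by (simp add: condA3_with_def)
    note rate = rate_at_top_A3[OF 2(1)]
    have "filterlim (\<lambda>t. (d * t) powr (\<tau> / \<alpha>)) at_top at_top"
      using d alpha_pos tau_pos by real_asymp
    from filterlim_compose[OF this filterlim_compose[OF 2(2) frechet_scale_at_top[OF rate]]]
    have "filterlim (\<lambda>n. (d * L (?s n)) powr (\<tau> / \<alpha>)) at_top sequentially" .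
    then show ?thesis
      using filterlim_cong[OF refl refl frechet_scale_light_A3[OF 2(1)]] rate by blast
  qed
  then show "filterlim rate at_top sequentially"
    and "filterlim (\<lambda>n. ?s n powr \<tau> / T n) at_top sequentially" by auto
qed

lemma frechet_condition_limit:
  assumes "frechet_condition \<tau> \<alpha> L k \<epsilon>"
  shows "(\<lambda>n. P n (frechet_scale F2 k \<epsilon> n * x)) \<longlonglongrightarrow> frechet_cdf \<alpha> x"
  using frechet_condition_rate[OF assms]
  by (intro frechet_limit frechet_scale_at_top heavy_part_tendsto_frechet_scale)

section \<open>The jump scale and the quantile scale in the discontinuous regime\<close>

context
  fixes d l :: real
  assumes disc: "discontinuous_condition \<tau> \<alpha> L k \<epsilon> d l"
begin

lemma disc_pos: "d > 0" "l > 0"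
  and disc_A3: "condA3_with \<tau> \<alpha> k \<epsilon> d" and disc_L: "(L \<longlongrightarrow> l) at_top"
  using disc by (auto simp: discontinuous_condition_def condA3_with_def)

text \<open>For this scale the Weibull part at the jump point is exactly \<open>1\<close>, for every \<open>n\<close>.\<close>

definition jump_scale :: "nat \<Rightarrow> real" where
  "jump_scale n = (d * l) powr (1 / \<alpha>) * T n powr (1 / \<tau>)"

lemma jump_scale_pos: "jump_scale n > 0"
proof -
  have "rate n = d * T n powr (\<alpha> / \<tau>)" using disc_A3 by (simp add: condA3_with_def)
  \<comment> \<open>As (A3) holds for every \<open>n\<close>, a row with \<open>k n = 1\<close>
    would have rate \<open>0\<close>; hence positivity for all \<open>n\<close> and not only for
    large ones.\<close>
  then have "T n \<noteq> 0" using rate_pos[of n] by auto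
  then show ?thesis using disc_pos by (simp add: jump_scale_def)
qed

lemma jump_scale_at_top: "filterlim jump_scale at_top sequentially"
proof -
  have c: "(d * l) powr (1 / \<alpha>) > 0" using disc_pos by simp
  have "filterlim (\<lambda>t::real. t powr (1 / \<tau>)) at_top at_top" using tau_pos by real_asymp
  from filterlim_tendsto_pos_mult_at_top[OF tendsto_const c filterlim_compose[OF this T_at_top]]
  show ?thesis by (simp add: jump_scale_def[abs_def])
qed

lemma jump_scale_limit: "(\<lambda>n. P n (jump_scale n * x)) \<longlonglongrightarrow> discontinuous_law lam \<tau> \<alpha> d l x"
proof (rule discontinuous_limit[OF jump_scale_at_top _ _ disc_pos])
  have light: "\<forall>\<^sub>F n in sequentially. jump_scale n powr \<tau> / T n = (d * l) powr (\<tau> / \<alpha>)"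
    using T_pos
    by eventually_elim (use disc_pos tau_pos in \<open>simp add: jump_scale_def powr_mult powr_powr\<close>)
  then show "(\<lambda>n. jump_scale n powr \<tau> / T n) \<longlonglongrightarrow> (d * l) powr (\<tau> / \<alpha>)"
    by (rule tendsto_eventually)
  show "(\<lambda>n. T n * (1 - jump_scale n powr \<tau> / T n / (d * l) powr (\<tau> / \<alpha>))) \<longlonglongrightarrow> 0"
    by (rule tendsto_eventually, use light in eventually_elim) (use disc_pos in simp)
  fix y :: real assume y: "y > 0"
  let ?r = "(d * l) powr (1 / \<alpha>) * y"
  have "(\<lambda>n. jump_scale n * y / T n powr (1 / \<tau>)) \<longlonglongrightarrow> ?r"
    by (rule tendsto_eventually, use T_pos in eventually_elim) (simp add: jump_scale_def)
  moreover have "filterlim (\<lambda>n. jump_scale n * y) at_top sequentially"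
    using filterlim_tendsto_pos_mult_at_top[OF tendsto_const y jump_scale_at_top]
    by (simp add: mult.commute)
  moreover have "?r > 0" using disc_pos y by simp
  ultimately have "(\<lambda>n. rate n * g (jump_scale n * y)) \<longlonglongrightarrow> d * ?r powr (- \<alpha>) * l"
    by (intro heavy_part_tendsto_A3[OF disc_A3 _ _ _ disc_L])
  \<comment> \<open>The constant in \<open>jump_scale\<close> is chosen for this cancellation of
    \<open>d * l\<close>.\<close>
  moreover have "d * ?r powr (- \<alpha>) * l = y powr (- \<alpha>)"
  proof -
    have "?r powr (- \<alpha>) = (d * l) powr (- 1) * y powr (- \<alpha>)"
      using disc_pos y alpha_pos by (simp add: powr_mult powr_powr del: powr_minus)
    also have "(d * l) powr (- 1) = 1 / (d * l)" using disc_pos by (simp add: powr_minus divide_inverse)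
    finally show ?thesis using disc_pos by simp
  qed
  ultimately show "(\<lambda>n. rate n * g (jump_scale n * y)) \<longlonglongrightarrow> y powr (- \<alpha>)" by simp
qed

text \<open>By \<open>frechet_scale_light_A3\<close> the Weibull exponent at the jump is
  \<open>T n * (1 - (L (s n) / l) powr (\<tau> / \<alpha>))\<close> for large \<open>n\<close>. Mere
  convergence of \<open>L\<close> does not control this product, so a rate is demanded, but only at
  the jump.\<close>

lemma disc_frechet_scale_limit:
  assumes "x = jump_point lam \<tau> \<alpha> d l \<Longrightarrow>
    (\<lambda>n. T n * (L (frechet_scale F2 k \<epsilon> n) - l)) \<longlonglongrightarrow> 0"
  shows "(\<lambda>n. P n (frechet_scale F2 k \<epsilon> n * x)) \<longlonglongrightarrow> discontinuous_law lam \<tau> \<alpha> d l x"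
proof -
  let ?s = "frechet_scale F2 k \<epsilon>" and ?\<rho> = "(d * l) powr (\<tau> / \<alpha>)"
  note rate = rate_at_top_A3[OF disc_A3]
  note s = frechet_scale_at_top[OF rate]
  note light = frechet_scale_light_A3[OF disc_A3]
  have Ls: "(\<lambda>n. L (?s n)) \<longlonglongrightarrow> l" using filterlim_compose[OF disc_L s] .
  have "(\<lambda>n. (d * L (?s n)) powr (\<tau> / \<alpha>)) \<longlonglongrightarrow> ?\<rho>"
    using disc_pos by (intro tendsto_intros Ls) auto
  then have lim: "(\<lambda>n. ?s n powr \<tau> / T n) \<longlonglongrightarrow> ?\<rho>"
    using tendsto_cong[OF light] by blast
  show ?thesis
  proof (rule discontinuous_limit[OF s heavy_part_tendsto_frechet_scale[OF rate] lim disc_pos])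
    assume "x = jump_point lam \<tau> \<alpha> d l"
    then have "(\<lambda>n. T n * (L (?s n) - l) / l) \<longlonglongrightarrow> 0 / l"
      using disc_pos by (intro tendsto_divide assms tendsto_const) auto
    then have "(\<lambda>n. T n * (L (?s n) / l - 1)) \<longlonglongrightarrow> 0"
      using disc_pos by (simp add: field_simps)
    moreover have "(\<lambda>n. L (?s n) / l) \<longlonglongrightarrow> 1"
      using tendsto_divide[OF Ls tendsto_const[of l]] disc_pos by simp
    ultimately have *: "(\<lambda>n. T n * (1 - (L (?s n) / l) powr (\<tau> / \<alpha>))) \<longlonglongrightarrow> 0"
      by (intro one_minus_powr_tendsto)
    have "\<forall>\<^sub>F n in sequentially. T n * (1 - (L (?s n) / l) powr (\<tau> / \<alpha>)) =
        T n * (1 - ?s n powr \<tau> / T n / ?\<rho>)"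
      using light eventually_compose_filterlim[OF L_pos s]
    proof eventually_elim
      case (elim n)
      show ?case unfolding elim(1) using elim(2) disc_pos by (simp add: powr_mult powr_divide)
    qed
    with * show "(\<lambda>n. T n * (1 - ?s n powr \<tau> / T n / ?\<rho>)) \<longlonglongrightarrow> 0"
      using tendsto_cong by fast
  qed
qed

end

end

subsection \<open>Classification\<close>

text \<open>The explicit scales are positive only for large \<open>n\<close>. Overwriting the others
  with \<open>1\<close> leaves the limit unchanged and gives scales positive for every
  \<open>n\<close>, as the existence claim demands.\<close>

lemma max_limit_everywhere_pos:
  assumes "max_limit M X k s c H"
  obtains s' where "\<And>n. s' n > 0" "max_limit M X k s' c H"
proof
  let ?s = "\<lambda>n. if s n > 0 then s n else 1"
  show "?s n > 0" for n by simp
  have "\<forall>\<^sub>F n in sequentially. ?s n = s n"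
    using assms unfolding max_limit_def by (auto elim: eventually_mono)
  then have "\<forall>\<^sub>F n in sequentially. max_prob M X k n (s n * x + c n) = max_prob M X k n (?s n * x + c n)" for x
    by eventually_elim simp
  then have "(\<lambda>n. max_prob M X k n (?s n * x + c n)) \<longlonglongrightarrow> H x" for x
    using assms unfolding max_limit_def by (blast intro: Lim_transform_eventually)
  then show "max_limit M X k ?s c H" by (simp add: max_limit_def)
qed

text \<open>Continuity of \<open>G\<close> is kept as a premise inside the conclusion so that the
  discontinuous law can serve as a reference limit as well.\<close>

lemma max_limit_same_type:
  assumes mono: "\<And>n. mono (max_prob M X k n)"
    and G: "max_limit M X k \<sigma> \<gamma> G"
    and G_less_1: "\<And>y. G y < 1"
    and pseudo_inv: "\<And>p. 0 < p \<Longrightarrow> p < 1 \<Longrightarrow> \<exists>y. (\<forall>z<y. G z < p) \<and> (\<forall>z>y. p < G z)"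
    and H: "max_limit M X k s c H" "nondegenerate_law H"
  obtains a b where "a > 0" "\<And>x. isCont G (a * x + b) \<Longrightarrow> H x = G (a * x + b)"
proof -
  note result = that
  show thesis
  proof (rule convergence_of_types[where P = "max_prob M X k" and \<sigma> = \<sigma> and \<gamma> = \<gamma>
        and s = s and c = c and G = G and H = H])
    show "mono (max_prob M X k n)" for n by (rule mono)
    show "\<forall>\<^sub>F n in sequentially. \<sigma> n > 0"
      and "(\<lambda>n. max_prob M X k n (\<sigma> n * y + \<gamma> n)) \<longlonglongrightarrow> G y" for y
      using G by (auto simp: max_limit_def)
    show "G y < 1" for y by (rule G_less_1)
    show "\<exists>y. (\<forall>z<y. G z < p) \<and> (\<forall>z>y. p < G z)" if "0 < p" "p < 1" for p
      using that by (rule pseudo_inv)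
    show "\<forall>\<^sub>F n in sequentially. s n > 0"
      and "(\<lambda>n. max_prob M X k n (s n * x + c n)) \<longlonglongrightarrow> H x" for x
      using H by (auto simp: max_limit_def)
    show "nondegenerate_law H" by (rule H)
    show thesis if "a > 0" "\<And>x. isCont G (a * x + b) \<Longrightarrow> H x = G (a * x + b)" for a b
      using that by (rule result)
  qed
qed

text \<open>(A3) is split off first because there the limit of \<open>L\<close> decides: zero,
  positive finite and infinite limits lead to the Gumbel, discontinuous and Frechet case.\<close>

lemma (in mixture_maxima) regime_cases:
  assumes "rate_regime \<tau> \<alpha> k \<epsilon>"
    and "\<exists>l::ereal. 0 \<le> l \<and> ((\<lambda>x. ereal (L x)) \<longlongrightarrow> l) at_top"
  shows "gumbel_condition \<tau> \<alpha> L k \<epsilon> \<or> frechet_condition \<tau> \<alpha> L k \<epsilon> \<or>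
    (\<exists>d l. discontinuous_condition \<tau> \<alpha> L k \<epsilon> d l)"
proof (cases "condA3 \<tau> \<alpha> k \<epsilon>")
  case True
  obtain l :: ereal where l: "0 \<le> l" "((\<lambda>x. ereal (L x)) \<longlongrightarrow> l) at_top" using assms(2) by blast
  show ?thesis
  proof (cases l)
    case (real r)
    then have "(L \<longlongrightarrow> r) at_top" "r \<ge> 0" using l by auto
    then show ?thesis using True
      by (cases "r = 0") (auto simp: gumbel_condition_def discontinuous_condition_def condA3_def)
  next
    case PInf
    then have "filterlim L at_top at_top" using l by (simp add: tendsto_PInfty_eq_at_top)
    then show ?thesis using True by (simp add: frechet_condition_def)
  qed (use l in auto)
next
  case False
  then show ?thesis
    using assms(1) by (auto simp: rate_regime_def gumbel_condition_def frechet_condition_def)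
qed

theorem theorem1:
  fixes M :: "'w measure"
    and X :: "nat \<Rightarrow> nat \<Rightarrow> 'w \<Rightarrow> real"
    and k :: "nat \<Rightarrow> nat"
    and \<epsilon> :: "nat \<Rightarrow> real"
    and lam \<tau> \<alpha> :: real
    and F2 L :: "real \<Rightarrow> real"
  assumes "prob_space M"
    and "lam > 0" and "\<tau> > 0" and "\<alpha> > 0"
    and "\<And>n. k n \<ge> 1" and "incseq k" and "filterlim k at_top sequentially"
    and "\<And>n. 0 < \<epsilon> n \<and> \<epsilon> n < 1" and "\<epsilon> \<longlonglongrightarrow> 0"
    and "regularly_varying_law \<alpha> L F2"
    and "\<exists>l::ereal. 0 \<le> l \<and> ((\<lambda>x. ereal (L x)) \<longlongrightarrow> l) at_top"
    and "\<And>n. prob_space.indep_vars M (\<lambda>_. borel) (X n) {1..k n}"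
    and "\<And>n j. j \<in> {1..k n} \<Longrightarrow>
           cdf (distr M borel (X n j)) = mixture_cdf (\<epsilon> n) (weibull_cdf lam \<tau>) F2"
    and "rate_regime \<tau> \<alpha> k \<epsilon>"
  shows
    "(\<exists>s c H. (\<forall>n. s n > 0) \<and> max_limit M X k s c H \<and> nondegenerate_law H \<and>
        (same_type H gumbel_cdf \<or> same_type H (frechet_cdf \<alpha>) \<or>
         (\<exists>d l. discontinuous_condition \<tau> \<alpha> L k \<epsilon> d l \<and>
                same_type H (discontinuous_law lam \<tau> \<alpha> d l))))
     \<and>
     (\<forall>s c H. max_limit M X k s c H \<and> nondegenerate_law H \<longrightarrow>
        (same_type H gumbel_cdf \<or> same_type H (frechet_cdf \<alpha>) \<or>
         (\<exists>d l. discontinuous_condition \<tau> \<alpha> L k \<epsilon> d l \<and>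
                same_type_off (jump_point lam \<tau> \<alpha> d l) H (discontinuous_law lam \<tau> \<alpha> d l))) \<and>
        (same_type H gumbel_cdf \<longleftrightarrow> gumbel_condition \<tau> \<alpha> L k \<epsilon>) \<and>
        (same_type H (frechet_cdf \<alpha>) \<longleftrightarrow> frechet_condition \<tau> \<alpha> L k \<epsilon>))
     \<and>
     (gumbel_condition \<tau> \<alpha> L k \<epsilon> \<longrightarrow>
        max_limit M X k (gumbel_scale lam \<tau> k) (gumbel_centre lam \<tau> k) gumbel_cdf)
     \<and>
     (frechet_condition \<tau> \<alpha> L k \<epsilon> \<longrightarrow>
        max_limit M X k (frechet_scale F2 k \<epsilon>) (\<lambda>_. 0) (frechet_cdf \<alpha>))
     \<and>
     (\<forall>d l. discontinuous_condition \<tau> \<alpha> L k \<epsilon> d l \<longrightarrow>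
        (\<exists>s c. (\<forall>n. s n > 0) \<and> max_limit M X k s c (discontinuous_law lam \<tau> \<alpha> d l)) \<and>
        (\<forall>\<^sub>F n in sequentially. frechet_scale F2 k \<epsilon> n > 0) \<and>
        (\<forall>x. x \<noteq> jump_point lam \<tau> \<alpha> d l \<longrightarrow>
           (\<lambda>n. max_prob M X k n (frechet_scale F2 k \<epsilon> n * x)) \<longlonglongrightarrow>
             discontinuous_law lam \<tau> \<alpha> d l x) \<and>
        ((\<lambda>n. ln (real (k n)) * (L (frechet_scale F2 k \<epsilon> n) - l)) \<longlonglongrightarrow> 0 \<longrightarrow>
           max_limit M X k (frechet_scale F2 k \<epsilon>) (\<lambda>_. 0) (discontinuous_law lam \<tau> \<alpha> d l)))"
proof -
  interpret mixture_maxima k \<epsilon> lam \<tau> \<alpha> F2 L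
    using assms by unfold_locales auto
  have P: "max_prob M X k n u = P n u" for n u
    unfolding P_def by (rule max_prob_eq_power) (use assms in auto)
  have mono: "mono (max_prob M X k n)" for n
    using mono_P[of n] by (simp add: mono_def P)
  let ?gu = "gumbel_condition \<tau> \<alpha> L k \<epsilon>" and ?fr = "frechet_condition \<tau> \<alpha> L k \<epsilon>"
    and ?disc = "discontinuous_condition \<tau> \<alpha> L k \<epsilon>"
  have gumbel: "max_limit M X k (gumbel_scale lam \<tau> k) (gumbel_centre lam \<tau> k) gumbel_cdf" if ?gu
    using gumbel_scale_pos gumbel_condition_limit[OF that] by (simp add: max_limit_def P)
  have frechet: "max_limit M X k (frechet_scale F2 k \<epsilon>) (\<lambda>_. 0) (frechet_cdf \<alpha>)" if ?fr
    using eventually_pos_if_at_top[OF frechet_scale_at_top[OF frechet_condition_rate(1)[OF that]]]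
      frechet_condition_limit[OF that]
    by (simp add: max_limit_def P)
  have disc: "max_limit M X k (jump_scale d l) (\<lambda>_. 0) (discontinuous_law lam \<tau> \<alpha> d l)"
    if "?disc d l" for d l
    using jump_scale_pos[OF that] jump_scale_limit[OF that] by (simp add: max_limit_def P)
  note cases = regime_cases[OF assms(14,11)]
  have gumbel_type: "same_type H gumbel_cdf"
    if "?gu" "max_limit M X k s c H" "nondegenerate_law H" for s c H
  proof (rule max_limit_same_type[OF mono gumbel[OF that(1)] gumbel_cdf_less_1
        gumbel_cdf_pseudo_inverse that(2,3)])
    fix a b :: real
    assume "a > 0" "\<And>x. isCont gumbel_cdf (a * x + b) \<Longrightarrow> H x = gumbel_cdf (a * x + b)"
    then show ?thesis unfolding same_type_def using isCont_gumbel_cdf by blast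
  qed
  have frechet_type: "same_type H (frechet_cdf \<alpha>)"
    if "?fr" "max_limit M X k s c H" "nondegenerate_law H" for s c H
  proof (rule max_limit_same_type[OF mono frechet[OF that(1)] frechet_cdf_less_1 _ that(2,3)])
    show "\<exists>y. (\<forall>z<y. frechet_cdf \<alpha> z < p) \<and> (\<forall>z>y. p < frechet_cdf \<alpha> z)" if "0 < p" "p < 1" for p
      using frechet_cdf_pseudo_inverse[OF alpha_pos that] by blast
    fix a b :: real
    assume "a > 0" "\<And>x. isCont (frechet_cdf \<alpha>) (a * x + b) \<Longrightarrow> H x = frechet_cdf \<alpha> (a * x + b)"
    then show ?thesis unfolding same_type_def using isCont_frechet_cdf[OF alpha_pos] by blast
  qed
  have disc_type: "same_type_off (jump_point lam \<tau> \<alpha> d l) H (discontinuous_law lam \<tau> \<alpha> d l)"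
    if "?disc d l" "max_limit M X k s c H" "nondegenerate_law H" for d l s c H
  proof -
    note pos = lam_pos alpha_pos disc_pos[OF that(1)]
    show ?thesis
    \<comment> \<open>The reference limit is the one along \<open>jump_scale\<close>, which exists
      at the jump without a rate on \<open>L\<close>.\<close>
    proof (rule max_limit_same_type[OF mono disc[OF that(1)] discontinuous_law_less_1[OF pos]
          discontinuous_law_pseudo_inverse[OF pos] that(2,3)])
      fix a b :: real
      assume "a > 0" "\<And>x. isCont (discontinuous_law lam \<tau> \<alpha> d l) (a * x + b) \<Longrightarrow>
        H x = discontinuous_law lam \<tau> \<alpha> d l (a * x + b)"
      then show ?thesis unfolding same_type_off_def using isCont_discontinuous_law[OF pos] by blast
    qed
  qed
  have exists: "\<exists>s c H. (\<forall>n. s n > 0) \<and> max_limit M X k s c H \<and> nondegenerate_law H \<and>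
        (same_type H gumbel_cdf \<or> same_type H (frechet_cdf \<alpha>) \<or>
         (\<exists>d l. ?disc d l \<and> same_type H (discontinuous_law lam \<tau> \<alpha> d l)))"
  proof -
    have refl: "same_type H H" for H
      unfolding same_type_def by (intro exI[of _ 1] conjI exI[of _ 0]) auto
    have "\<exists>s c H. max_limit M X k s c H \<and> nondegenerate_law H \<and>
        (same_type H gumbel_cdf \<or> same_type H (frechet_cdf \<alpha>) \<or>
         (\<exists>d l. ?disc d l \<and> same_type H (discontinuous_law lam \<tau> \<alpha> d l)))"
      using cases
    proof (elim disjE exE)
      assume ?gu
      then show ?thesis using gumbel nondegenerate_gumbel_cdf refl by blast
    next
      assume ?fr
      then show ?thesis using frechet nondegenerate_frechet_cdf[OF alpha_pos] refl by blast
    next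
      fix d l assume "?disc d l"
      then show ?thesis
        using disc nondegenerate_discontinuous_law[OF lam_pos alpha_pos disc_pos] refl by blast
    qed
    then show ?thesis using max_limit_everywhere_pos by metis
  qed
  \<comment> \<open>If the condition of another type held as well, that type would be forced on the
    same \<open>H\<close>, contradicting incompatibility.\<close>
  have types: "(same_type H gumbel_cdf \<or> same_type H (frechet_cdf \<alpha>) \<or>
         (\<exists>d l. ?disc d l \<and>
                same_type_off (jump_point lam \<tau> \<alpha> d l) H (discontinuous_law lam \<tau> \<alpha> d l))) \<and>
        (same_type H gumbel_cdf \<longleftrightarrow> ?gu) \<and> (same_type H (frechet_cdf \<alpha>) \<longleftrightarrow> ?fr)"
    if "max_limit M X k s c H" "nondegenerate_law H" for s c H
    using cases
  proof (elim disjE exE)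
    assume ?gu
    then have "same_type H gumbel_cdf" using gumbel_type that by blast
    then show ?thesis using \<open>?gu\<close> not_same_type_gumbel_frechet frechet_type that by blast
  next
    assume ?fr
    then have "same_type H (frechet_cdf \<alpha>)" using frechet_type that by blast
    then show ?thesis using \<open>?fr\<close> not_same_type_gumbel_frechet gumbel_type that by blast
  next
    fix d l assume d: "?disc d l"
    note pos = lam_pos alpha_pos disc_pos[OF d]
    note H = disc_type[OF d that]
    show ?thesis
      using d H not_same_type_gumbel_discontinuous[OF pos H] not_same_type_frechet_discontinuous[OF pos H]
        gumbel_type frechet_type that by blast
  qed
  have disc_all: "(\<exists>s c. (\<forall>n. s n > 0) \<and> max_limit M X k s c (discontinuous_law lam \<tau> \<alpha> d l)) \<and>
        (\<forall>\<^sub>F n in sequentially. frechet_scale F2 k \<epsilon> n > 0) \<and>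
        (\<forall>x. x \<noteq> jump_point lam \<tau> \<alpha> d l \<longrightarrow>
           (\<lambda>n. max_prob M X k n (frechet_scale F2 k \<epsilon> n * x)) \<longlonglongrightarrow>
             discontinuous_law lam \<tau> \<alpha> d l x) \<and>
        ((\<lambda>n. ln (real (k n)) * (L (frechet_scale F2 k \<epsilon> n) - l)) \<longlonglongrightarrow> 0 \<longrightarrow>
           max_limit M X k (frechet_scale F2 k \<epsilon>) (\<lambda>_. 0) (discontinuous_law lam \<tau> \<alpha> d l))"
    if d: "?disc d l" for d l
  proof (intro conjI)
    show "\<exists>s c. (\<forall>n. s n > 0) \<and> max_limit M X k s c (discontinuous_law lam \<tau> \<alpha> d l)"
      using jump_scale_pos[OF d] disc[OF d] by blast
    show pos: "\<forall>\<^sub>F n in sequentially. frechet_scale F2 k \<epsilon> n > 0"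
      using eventually_pos_if_at_top[OF frechet_scale_at_top[OF rate_at_top_A3[OF disc_A3[OF d]]]] .
    \<comment> \<open>Off the jump the premise of \<open>disc_frechet_scale_limit\<close> is
      vacuous.\<close>
    show "\<forall>x. x \<noteq> jump_point lam \<tau> \<alpha> d l \<longrightarrow>
        (\<lambda>n. max_prob M X k n (frechet_scale F2 k \<epsilon> n * x)) \<longlonglongrightarrow> discontinuous_law lam \<tau> \<alpha> d l x"
      using disc_frechet_scale_limit[OF d] by (simp add: P)
    show "(\<lambda>n. ln (real (k n)) * (L (frechet_scale F2 k \<epsilon> n) - l)) \<longlonglongrightarrow> 0 \<longrightarrow>
        max_limit M X k (frechet_scale F2 k \<epsilon>) (\<lambda>_. 0) (discontinuous_law lam \<tau> \<alpha> d l)"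
      using disc_frechet_scale_limit[OF d] pos by (simp add: max_limit_def P)
  qed
  show ?thesis
    using exists types gumbel frechet disc_all by (intro conjI allI impI) blast+
qed

end
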